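(* Let $X$ be a real-valued Lévy process with generating triplet $(A,\nu,\gamma)$ ($A\ge0$ the Gaussian coefficient, $\nu$ the Lévy measure, $\gamma$ the drift), and let $S>0$, $c>0$. For any $\alpha>0$, $$\mathbf{E}\exp\big(\alpha\,TV^c(X,S)\big)<+\infty\quad\Longleftrightarrow\quad\int_{|x|>1}e^{\alpha|x|}\,\nu(dx)<+\infty.$$
   Context: For a càdlàg function $f$ and $c>0$, $TV^c(f,S)=\sup_n\sup_{0\le t_0<\dots<t_n\le S}\sum_{i=1}^n\max\{|f(t_i)-f(t_{i-1})|-c,0\}$. *)

theory Defs
  imports "HOL-Probability.Probability"
begin

definition cadlag :: "(real \<Rightarrow> real) \<Rightarrow> bool" where
  "cadlag f \<longleftrightarrow> (\<forall>t\<ge>0. continuous (at_right t) f) \<and>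
                 (\<forall>t>0. \<exists>l. (f \<longlongrightarrow> l) (at_left t))"

definition TVc :: "real \<Rightarrow> (real \<Rightarrow> real) \<Rightarrow> real \<Rightarrow> ennreal" where
  "TVc c f S = (SUP (n, t) \<in> {(n::nat, t::nat \<Rightarrow> real).
        0 \<le> t 0 \<and> (\<forall>i<n. t i < t (Suc i)) \<and> t n \<le> S}.
        ennreal (\<Sum>i\<in>{1..n}. max (\<bar>f (t i) - f (t (i - 1))\<bar> - c) 0))"

definition exp_ennreal :: "real \<Rightarrow> ennreal \<Rightarrow> ennreal" where
  "exp_ennreal \<alpha> x = (if x = \<infinity> then \<infinity> else ennreal (exp (\<alpha> * enn2real x)))"

definition levy_measure :: "real measure \<Rightarrow> bool" where
  "levy_measure \<nu> \<longleftrightarrow> sets \<nu> = sets borel \<and> emeasure \<nu> {0} = 0 \<and>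
     (\<integral>\<^sup>+ x. ennreal (min 1 (x\<^sup>2)) \<partial>\<nu>) < \<infinity>"

definition levy_exponent :: "real \<Rightarrow> real measure \<Rightarrow> real \<Rightarrow> real \<Rightarrow> complex" where
  "levy_exponent A \<nu> \<gamma> u =
     \<i> * complex_of_real (\<gamma> * u) - complex_of_real (A * u\<^sup>2 / 2) +
     (CLINT x|\<nu>. iexp (u * x) - 1 - \<i> * complex_of_real (u * x * indicator {-1..1} x))"

definition levy_process ::
  "'a measure \<Rightarrow> (real \<Rightarrow> 'a \<Rightarrow> real) \<Rightarrow> real \<Rightarrow> real measure \<Rightarrow> real \<Rightarrow> bool" where
  "levy_process M X A \<nu> \<gamma> \<longleftrightarrow>
     prob_space M \<and>
     (\<forall>t\<ge>0. X t \<in> borel_measurable M) \<and>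
     (\<forall>\<omega>\<in>space M. X 0 \<omega> = 0) \<and>
     (\<forall>\<omega>\<in>space M. cadlag (\<lambda>t. X t \<omega>)) \<and>
     (\<forall>(n::nat) (t::nat \<Rightarrow> real). 0 \<le> t 0 \<and> (\<forall>i<n. t i \<le> t (Suc i)) \<longrightarrow>
        prob_space.indep_vars M (\<lambda>_. borel) (\<lambda>i \<omega>. X (t (Suc i)) \<omega> - X (t i) \<omega>) {..<n}) \<and>
     (\<forall>s\<ge>0. \<forall>t\<ge>0. distr M borel (\<lambda>\<omega>. X (s + t) \<omega> - X s \<omega>) = distr M borel (X t)) \<and>
     A \<ge> 0 \<and> levy_measure \<nu> \<and>
     (\<forall>t\<ge>0. \<forall>u. char (distr M borel (X t)) u = exp (complex_of_real t * levy_exponent A \<nu> \<gamma> u))"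

end

theory Submission
  imports Defs
begin

text \<open>
  Cut the interval into \<open>n\<close> pieces and let \<open>Y\<close> be the increment over one of them. The second
  differences of the Levy exponent along Gaussian shifts are Fourier transforms of finite measures,
  so Levy's continuity theorem gives \<open>n E f(Y) \<longlonglongrightarrow> S \<integral> f d\<nu>\<close> for bounded continuous \<open>f\<close> vanishing near \<open>0\<close>.

  If the exponential moment is finite, then independence of the increments gives
  \<open>(E exp (\<alpha> max (\<bar>Y\<bar> - c) 0))\<^sup>n \<le> K\<close>, hence \<open>n E (exp (\<alpha> max (\<bar>Y\<bar> - c) 0) - 1) \<le> K\<close> by Bernoulli's
  inequality, and the limit bounds the integral with respect to \<open>\<nu>\<close>.

  Conversely, the truncated variation of the sampled path is at most the variation \<open>V\<close> of the lazy path
  that moves only as much as needed to stay within \<open>c/2\<close> of the samples. With \<open>d\<close> the current gap and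
  \<open>\<kappa>\<close> the Huber function, \<open>E exp (\<alpha> min (V + \<kappa> d) m)\<close> grows per step by a factor
  at most \<open>1 + R / n\<close> once \<open>n\<close> is large depending on \<open>m\<close>, where \<open>R\<close> does not depend on \<open>m\<close>;
  Fatou's lemma concludes.
\<close>

section \<open>Convergence of finite measures and Levy exponents\<close>

text \<open>In the converse direction the obstacle is that E |Y| can be of order n^(-1/2), so
  charging every step with |Y| would cost a factor exponential in sqrt n. Adding the Huber term
  makes the potential continuously differentiable in the increment: the first-order term is then a
  bounded coefficient, fixed by the past, times Y, and only the truncated mean and second moment of
  Y matter. Both are O(1 / n). They are measured by the sine and by the minimum of 1 and the square,
  since characteristic functions control these bounded functions. The small-time limit covers
  bounded test functions only, hence the cap m. The number of steps is chosen after m, and the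
  resulting diagonal sequence of grids has mesh tending to 0, which lets the sampled paths recover
  the truncated variation. A first Gaussian difference of the exponent would still contain the
  constant A / 2, an atom at 0 of the limit measure. A second difference leaves only the Levy
  measure, multiplied by a weight of order x^4 at 0.\<close>

lemma finite_measure_levy_continuity:
  fixes M :: "nat \<Rightarrow> real measure" and N :: "real measure" and f :: "real \<Rightarrow> real"
  assumes M: "\<And>n. finite_measure (M n)" "\<And>n. sets (M n) = sets borel"
    and N: "finite_measure N" "sets N = sets borel"
    and conv: "\<And>u. (\<lambda>n. CLINT x|M n. iexp (u * x)) \<longlonglongrightarrow> (CLINT x|N. iexp (u * x))"
    and f: "\<And>x. isCont f x" "\<And>x. \<bar>f x\<bar> \<le> B"
  shows "(\<lambda>n. LINT x|M n. f x) \<longlonglongrightarrow> (LINT x|N. f x)"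
proof -
  interpret M: finite_measure "M n" for n by (rule M)
  interpret N: finite_measure N by (rule N)
  have sp: "space (M n) = UNIV" "space N = UNIV" for n
    using sets_eq_imp_space_eq[OF M(2)[of n]] sets_eq_imp_space_eq[OF N(2)] by auto
  have [measurable_cong]: "sets (M n) = sets borel" "sets N = sets borel" for n
    using M N by auto
  have fm[measurable]: "f \<in> borel_measurable borel"
    using f(1) by (simp add: borel_measurable_continuous_onI continuous_at_imp_continuous_on)
  define a where "a n = measure (M n) UNIV" for n
  define l where "l = measure N UNIV"
  \<comment> \<open>The transform at u = 0 is the total mass.\<close>
  have mass: "a \<longlonglongrightarrow> l"
  proof -
    have "(\<lambda>n. complex_of_real (a n)) \<longlonglongrightarrow> complex_of_real l"
      using conv[of 0] by (simp add: sp a_def l_def scaleR_conv_of_real)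
    then show ?thesis
      by (simp add: tendsto_of_real_iff)
  qed
  have bd: "\<bar>LINT x|M n. f x\<bar> \<le> B * a n" for n
  proof -
    have int: "integrable (M n) f"
      using f(2) by (intro M.integrable_const_bound[where B=B]) auto
    have "\<bar>LINT x|M n. f x\<bar> \<le> (LINT x|M n. \<bar>f x\<bar>)"
      by (rule integral_abs_bound)
    also have "\<dots> \<le> (LINT x|M n. B)"
      using int f(2) by (intro integral_mono) auto
    finally show ?thesis by (simp add: a_def sp mult.commute)
  qed
  show ?thesis
  \<comment> \<open>Levy's theorem is about probability measures, so the masses are divided out. For
    a zero limit this is impossible, but there \<open>bd\<close> already forces convergence to
    0.\<close>
  proof (cases "l = 0")
    case True
    have "N = null_measure N"
    proof (rule measure_eqI)
      fix A assume "A \<in> sets N"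
      have "measure N A \<le> 0" using N.bounded_measure[of A] True by (simp add: l_def sp)
      then have "measure N A = 0" by (simp add: antisym)
      then show "emeasure N A = emeasure (null_measure N) A"
        by (simp add: N.emeasure_eq_measure)
    qed simp
    then have "(LINT x|N. f x) = 0"
      by (metis integral_null_measure)
    moreover have "(\<lambda>n. LINT x|M n. f x) \<longlonglongrightarrow> 0"
    proof (rule Lim_null_comparison)
      show "(\<lambda>n. B * a n) \<longlonglongrightarrow> 0" using tendsto_mult_left[OF mass, of B] True by simp
    qed (use bd in auto)
    ultimately show ?thesis by simp
  next
    case False
    then have "l > 0" by (simp add: l_def zero_less_measure_iff less_le)
    then have "eventually (\<lambda>n. a n > 0) sequentially"
      using mass order_tendstoD(1) by blast
    then obtain n0 where n0: "\<And>n. n \<ge> n0 \<Longrightarrow> a n > 0"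
      by (auto simp: eventually_sequentially)
    have nrm: "real_distribution (density K (\<lambda>_. 1 / measure K UNIV))"
      if "finite_measure K" "sets K = sets borel" "measure K UNIV > 0" for K :: "real measure"
    proof -
      interpret K: finite_measure K by fact
      have "space K = UNIV" using sets_eq_imp_space_eq[OF that(2)] by simp
      then have "emeasure (density K (\<lambda>_. ennreal (1 / measure K UNIV))) UNIV = 1"
        using that(3) by (subst emeasure_density)
          (auto simp: that(2) K.emeasure_eq_measure nn_integral_cmult simp flip: ennreal_mult' sets_eq_imp_space_eq)
      then show ?thesis
        using that(2) \<open>space K = UNIV\<close> by (intro real_distribution.intro prob_spaceI real_distribution_axioms.intro) auto
    qed
    let ?M = "\<lambda>n. density (M (n + n0)) (\<lambda>_. 1 / a (n + n0))"
    let ?N = "density N (\<lambda>_. 1 / l)"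
    have pos: "a (n + n0) > 0" for n using n0 by simp
    have RM: "real_distribution (?M n)" for n
      using nrm[OF M(1) M(2), of "n + n0"] n0[of "n + n0"] by (simp add: a_def)
    have RN: "real_distribution ?N"
      using nrm[OF N(1) N(2)] \<open>l > 0\<close> by (simp add: l_def)
    have ch: "(\<lambda>n. char (?M n) u) \<longlonglongrightarrow> char ?N u" for u
    proof -
      have "char (?M n) u = (CLINT x|M (n + n0). iexp (u * x)) / a (n + n0)" for n
        unfolding char_def using pos[of n] by (subst integral_density) (auto simp: scaleR_conv_of_real)
      moreover have "char ?N u = (CLINT x|N. iexp (u * x)) / l"
        unfolding char_def using \<open>l > 0\<close> by (subst integral_density) (auto simp: scaleR_conv_of_real)
      moreover have "(\<lambda>n. (CLINT x|M (n + n0). iexp (u * x)) / a (n + n0)) \<longlonglongrightarrow> (CLINT x|N. iexp (u * x)) / l"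
        using LIMSEQ_ignore_initial_segment[OF conv, of n0] LIMSEQ_ignore_initial_segment[OF mass, of n0] \<open>l > 0\<close>
        by (intro tendsto_divide tendsto_of_real) auto
      ultimately show ?thesis by simp
    qed
    have "weak_conv_m ?M ?N"
      by (rule levy_continuity[OF RM RN ch])
    then have "(\<lambda>n. LINT x|?M n. f x) \<longlonglongrightarrow> (LINT x|?N. f x)"
      by (rule weak_conv_imp_integral_bdd_continuous_conv[OF RM RN, where B=B]) (use f in auto)
    moreover have "(LINT x|?M n. f x) = (LINT x|M (n + n0). f x) / a (n + n0)" for n
      using pos[of n] by (subst integral_density) auto
    moreover have "(LINT x|?N. f x) = (LINT x|N. f x) / l"
      using \<open>l > 0\<close> by (subst integral_density) auto
    ultimately have "(\<lambda>n. (LINT x|M (n + n0). f x) / a (n + n0)) \<longlonglongrightarrow> (LINT x|N. f x) / l"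
      by simp
    from tendsto_mult[OF this LIMSEQ_ignore_initial_segment[OF mass, of n0]]
    have "(\<lambda>n. LINT x|M (n + n0). f x) \<longlonglongrightarrow> (LINT x|N. f x)"
      using \<open>l > 0\<close> pos by (simp add: less_imp_neq[THEN not_sym])
    then show ?thesis by (rule LIMSEQ_offset)
  qed
qed

section \<open>Integrability against a Levy measure and growth of the exponent\<close>

lemma levy_measure_integrable_min:
  assumes "levy_measure \<nu>"
  shows "integrable \<nu> (\<lambda>x. min 1 (x\<^sup>2))"
proof -
  have [measurable_cong]: "sets \<nu> = sets borel" using assms by (simp add: levy_measure_def)
  show ?thesis
    using assms by (intro integrableI_bounded) (auto simp: levy_measure_def)
qed

text \<open>This opens the way to Fubini. By Markov's inequality the superlevel sets of
  \<open>min 1 (x\<^sup>2)\<close> have finite measure; they cover everything except 0, which has no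
  mass.\<close>

lemma levy_measure_sigma_finite:
  assumes "levy_measure \<nu>"
  shows "sigma_finite_measure \<nu>"
proof -
  have s[measurable_cong]: "sets \<nu> = sets borel" using assms by (simp add: levy_measure_def)
  have sp: "space \<nu> = UNIV" using sets_eq_imp_space_eq[OF s] by simp
  let ?A = "\<lambda>n::nat. {x::real. min 1 (x\<^sup>2) \<ge> 1 / Suc n}"
  have "emeasure \<nu> (?A n) < \<infinity>" for n
  proof -
    have "emeasure \<nu> (?A n) = (\<integral>\<^sup>+x. indicator (?A n) x \<partial>\<nu>)"
      by (intro nn_integral_indicator[symmetric]) (simp add: s)
    also have "\<dots> \<le> (\<integral>\<^sup>+x. ennreal (Suc n) * ennreal (min 1 (x\<^sup>2)) \<partial>\<nu>)"
    proof (rule nn_integral_mono)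
      fix x show "indicator (?A n) x \<le> ennreal (Suc n) * ennreal (min 1 (x\<^sup>2))"
        by (auto simp: indicator_def field_simps min_def simp flip: ennreal_mult intro!: ennreal_leI simp del: of_nat_Suc split: if_splits)
    qed
    also have "\<dots> = ennreal (Suc n) * (\<integral>\<^sup>+x. ennreal (min 1 (x\<^sup>2)) \<partial>\<nu>)"
      by (rule nn_integral_cmult) simp
    also have "\<dots> < \<infinity>" using assms by (auto simp: levy_measure_def ennreal_mult_less_top simp del: of_nat_Suc)
    finally show ?thesis .
  qed
  moreover have "emeasure \<nu> {0} < \<infinity>" using assms by (simp add: levy_measure_def)
  moreover have "\<exists>n. x \<in> ?A n" if "x \<noteq> 0" for x :: real
  proof -
    have "min 1 (x\<^sup>2) > 0" using that by simp
    then obtain n where "inverse (real (Suc n)) < min 1 (x\<^sup>2)" using reals_Archimedean by blast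
    then have "x \<in> ?A n" by (auto simp: inverse_eq_divide)
    then show ?thesis by blast
  qed
  then have "\<Union>(insert {0} (range ?A)) = UNIV" by blast
  moreover have "countable (insert {0} (range ?A))" by simp
  moreover have "insert {0} (range ?A) \<subseteq> sets \<nu>" by (auto simp: s)
  ultimately show ?thesis
    by (intro sigma_finite_measure.intro exI[of _ "insert {0} (range ?A)"]) (auto simp: sp less_top)
qed

text \<open>One constant serves two regimes: \<open>u\<^sup>2\<close> covers the second-order Taylor
  remainder on [-1, 1], and 2 covers the two unimodular terms outside, where the compensator
  vanishes.\<close>

lemma levy_integrand_bound:
  "cmod (iexp (u * x) - 1 - \<i> * complex_of_real (u * x * indicator {-1..1} x)) \<le> (2 + u\<^sup>2) * min 1 (x\<^sup>2)"
proof (cases "\<bar>x\<bar> \<le> 1")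
  case True
  have "cmod (iexp (u * x) - (\<Sum>k\<le>1. (\<i> * (u * x)) ^ k / fact k)) \<le> \<bar>u * x\<bar> ^ (Suc 1) / fact (Suc 1)"
    using iexp_approx1[of "u * x" 1] by simp
  then have "cmod (iexp (u * x) - 1 - \<i> * complex_of_real (u * x)) \<le> (u * x)\<^sup>2 / 2"
    by (simp add: power2_eq_square algebra_simps abs_mult)
  also have "\<dots> \<le> (2 + u\<^sup>2) * x\<^sup>2" by (simp add: power_mult_distrib algebra_simps)
  also have "\<dots> = (2 + u\<^sup>2) * min 1 (x\<^sup>2)" using True by (simp add: min_absorb2 abs_square_le_1)
  finally show ?thesis using True by (auto simp: abs_le_iff)
next
  case False
  then have "x\<^sup>2 > 1" using abs_square_le_1[of x] by simp
  have "indicator {-1..1} x = (0::real)" using False by (auto simp: abs_le_iff)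
  then have "cmod (iexp (u * x) - 1 - \<i> * complex_of_real (u * x * indicator {-1..1} x)) \<le> cmod (iexp (u * x)) + cmod 1"
    using norm_triangle_ineq4[of "iexp (u * x)" 1] by simp
  also have "\<dots> \<le> (2 + u\<^sup>2) * 1" by simp
  finally show ?thesis using \<open>x\<^sup>2 > 1\<close> by simp
qed

lemma levy_integrand_integrable:
  assumes "levy_measure \<nu>"
  shows "integrable \<nu> (\<lambda>x. iexp (u * x) - 1 - \<i> * complex_of_real (u * x * indicator {-1..1} x))"
proof (rule Bochner_Integration.integrable_bound)
  have [measurable_cong]: "sets \<nu> = sets borel" using assms by (simp add: levy_measure_def)
  show "integrable \<nu> (\<lambda>x. (2 + u\<^sup>2) * min 1 (x\<^sup>2))"
    by (intro integrable_mult_right levy_measure_integrable_min assms)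
  show "(\<lambda>x. iexp (u * x) - 1 - \<i> * complex_of_real (u * x * indicator {-1..1} x)) \<in> borel_measurable \<nu>"
    by measurable
  show "AE x in \<nu>. cmod (iexp (u * x) - 1 - \<i> * complex_of_real (u * x * indicator {-1..1} x))
      \<le> norm ((2 + u\<^sup>2) * min 1 (x\<^sup>2))"
    using levy_integrand_bound by (auto intro!: order_trans[OF _ abs_ge_self])
qed

text \<open>Quadratic growth is integrable under Gaussian shifts of u, so this supplies the
  dominating function in \<open>second_average_scaled_tendsto\<close>.\<close>

lemma levy_exponent_bound:
  assumes "levy_measure \<nu>"
  shows "\<exists>B. \<forall>u. cmod (levy_exponent A \<nu> \<gamma> u) \<le> B * (1 + u\<^sup>2)"
proof -
  let ?I = "LINT x|\<nu>. min 1 (x\<^sup>2)"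
  have [measurable_cong]: "sets \<nu> = sets borel" using assms by (simp add: levy_measure_def)
  have I: "?I \<ge> 0" by (rule integral_nonneg_AE) auto
  have "cmod (levy_exponent A \<nu> \<gamma> u) \<le> (\<bar>\<gamma>\<bar> + \<bar>A\<bar> + 2 * ?I) * (1 + u\<^sup>2)" for u
  proof -
    have "cmod (CLINT x|\<nu>. iexp (u * x) - 1 - \<i> * complex_of_real (u * x * indicator {-1..1} x))
        \<le> (LINT x|\<nu>. (2 + u\<^sup>2) * min 1 (x\<^sup>2))"
      by (rule Bochner_Integration.integral_norm_bound_integral[OF levy_integrand_integrable[OF assms]])
        (use levy_measure_integrable_min[OF assms] levy_integrand_bound in auto)
    also have "\<dots> = (2 + u\<^sup>2) * ?I" by simp
    also have "\<dots> \<le> 2 * ?I * (1 + u\<^sup>2)" using I by (simp add: algebra_simps)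
    finally have 1: "cmod (CLINT x|\<nu>. iexp (u * x) - 1 - \<i> * complex_of_real (u * x * indicator {-1..1} x)) \<le> 2 * ?I * (1 + u\<^sup>2)" .
    have "\<bar>u\<bar> \<le> 1 + u\<^sup>2"
      using zero_le_power2[of "\<bar>u\<bar> - 1"] by (simp add: power2_diff) 
    then have "\<bar>\<gamma>\<bar> * \<bar>u\<bar> \<le> \<bar>\<gamma>\<bar> * (1 + u\<^sup>2)" by (rule mult_left_mono) simp
    moreover have "\<bar>A * u\<^sup>2 / 2\<bar> \<le> \<bar>A\<bar> * (1 + u\<^sup>2)"
      by (simp add: abs_mult algebra_simps)
    moreover have "cmod (\<i> * complex_of_real (\<gamma> * u)) = \<bar>\<gamma>\<bar> * \<bar>u\<bar>"
      by (simp add: norm_mult abs_mult)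
    moreover have "cmod (complex_of_real (A * u\<^sup>2 / 2)) = \<bar>A * u\<^sup>2 / 2\<bar>"
      by (rule norm_of_real)
    moreover have "cmod (levy_exponent A \<nu> \<gamma> u) \<le> cmod (\<i> * complex_of_real (\<gamma> * u)) + cmod (complex_of_real (A * u\<^sup>2 / 2))
        + cmod (CLINT x|\<nu>. iexp (u * x) - 1 - \<i> * complex_of_real (u * x * indicator {-1..1} x))"
      unfolding levy_exponent_def
      by (intro order_trans[OF norm_triangle_ineq] add_right_mono norm_triangle_ineq4)
    ultimately show ?thesis using 1 unfolding distrib_right by linarith
  qed
  then show ?thesis by blast
qed

section \<open>Gaussian averages of characteristic functions and exponents\<close>

text \<open>One minus the standard normal characteristic function. It is comparable to
  \<open>min 1 (x\<^sup>2)\<close> in both directions, and it arises from averaging a characteristic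
  function over Gaussian shifts of its argument.\<close>

definition gauss_weight :: "real \<Rightarrow> real" where
  "gauss_weight x = 1 - exp (- x\<^sup>2 / 2)"

lemma gauss_weight_borel [measurable]: "gauss_weight \<in> borel_measurable borel"
  unfolding gauss_weight_def by measurable

lemma gauss_weight_nonneg: "0 \<le> gauss_weight x"
  by (simp add: gauss_weight_def)

lemma gauss_weight_le: "gauss_weight x \<le> min 1 (x\<^sup>2)"
proof -
  have "1 + (- x\<^sup>2 / 2) \<le> exp (- x\<^sup>2 / 2)" by (rule exp_ge_add_one_self)
  then have "gauss_weight x \<le> x\<^sup>2 / 2" by (simp add: gauss_weight_def)
  also have "\<dots> \<le> x\<^sup>2" by simp
  finally show ?thesis by (simp add: gauss_weight_def)
qed

lemma min_le_gauss_weight: "min 1 (x\<^sup>2) \<le> 3 * gauss_weight x"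
proof -
  define y where "y = x\<^sup>2"
  have y: "y \<ge> 0" by (simp add: y_def)
  have "1 + y / 2 \<le> exp (y / 2)" by (rule exp_ge_add_one_self)
  then have "exp (- (y / 2)) \<le> 1 / (1 + y / 2)"
    using y by (simp add: exp_minus field_simps)
  then have "gauss_weight x \<ge> 1 - 1 / (1 + y / 2)"
    by (simp add: gauss_weight_def y_def)
  moreover have "1 - 1 / (1 + y / 2) = y / (2 + y)" using y by (simp add: field_simps)
  \<comment> \<open>The constant 3 is the value of 2 + y at y = 1, where the two regimes
    meet.\<close>
  moreover have "min 1 y \<le> 3 * (y / (2 + y))"
  proof (cases "y \<le> 1")
    case True
    then have "y * (2 + y) \<le> y * 3" using y by (intro mult_left_mono) auto
    then show ?thesis using True y by (simp add: field_simps)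
  next
    case False
    then show ?thesis by (simp add: field_simps)
  qed
  ultimately show ?thesis by (simp add: y_def)
qed

lemma normal_average_iexp:
  "(CLINT z|std_normal_distribution. iexp ((u + s * z) * x)) = iexp (u * x) * complex_of_real (exp (- (s * x)\<^sup>2 / 2))"
proof -
  have "(CLINT z|std_normal_distribution. iexp ((u + s * z) * x)) = (CLINT z|std_normal_distribution. iexp (u * x) * iexp ((s * x) * z))"
    by (intro Bochner_Integration.integral_cong) (auto simp: algebra_simps simp flip: exp_add)
  also have "\<dots> = iexp (u * x) * char std_normal_distribution (s * x)"
    unfolding char_def by (rule integral_mult_right_zero)
  finally show ?thesis by (simp add: char_std_normal_distribution)
qed

text \<open>The combination annihilates quadratic polynomials, so it removes both the drift and the
  Gaussian part of a Levy exponent.\<close>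

definition second_average :: "(real \<Rightarrow> complex) \<Rightarrow> real \<Rightarrow> complex" where
  "second_average f u = f u - 2 * (CLINT z|std_normal_distribution. f (u + 1 * z))
     + (CLINT z|std_normal_distribution. f (u + sqrt 2 * z))"

lemma normal_average_char:
  assumes "real_distribution \<mu>"
  shows "(CLINT z|std_normal_distribution. char \<mu> (u + s * z)) = (CLINT x|\<mu>. iexp (u * x) * complex_of_real (exp (- (s * x)\<^sup>2 / 2)))"
proof -
  interpret \<mu>: real_distribution \<mu> by fact
  interpret N: real_distribution std_normal_distribution by (rule real_dist_normal_dist)
  interpret P: pair_prob_space \<mu> std_normal_distribution by unfold_locales
  have "(CLINT z|std_normal_distribution. char \<mu> (u + s * z)) = (CLINT x|\<mu>. CLINT z|std_normal_distribution. iexp ((u + s * z) * x))"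
    unfolding char_def
    by (rule P.Fubini_integral) (auto intro!: P.integrable_const_bound[where B=1])
  then show ?thesis by (simp only: normal_average_iexp)
qed

text \<open>The shifts have variances 0, 1 and 2, so the multipliers are 1, e and the square of e
  with e = exp (-x^2 / 2). The weights 1, -2, 1 combine them into the square of 1 - e.\<close>

lemma second_average_char:
  assumes "real_distribution \<mu>"
  shows "second_average (char \<mu>) u = (CLINT x|\<mu>. iexp (u * x) * complex_of_real ((gauss_weight x)\<^sup>2))"
proof -
  interpret \<mu>: real_distribution \<mu> by fact
  have i: "integrable \<mu> (\<lambda>x. iexp (u * x) * complex_of_real (exp (- (s * x)\<^sup>2 / 2)))" for s
    by (rule \<mu>.integrable_const_bound[where B=1]) (auto simp: norm_mult)
  have i1: "integrable \<mu> (\<lambda>x. iexp (u * x))"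
    by (rule \<mu>.integrable_const_bound[where B=1]) auto
  have "second_average (char \<mu>) u = (CLINT x|\<mu>. iexp (u * x)
      - 2 * (iexp (u * x) * complex_of_real (exp (- (1 * x)\<^sup>2 / 2)))
      + iexp (u * x) * complex_of_real (exp (- (sqrt 2 * x)\<^sup>2 / 2)))"
    unfolding second_average_def normal_average_char[OF assms] unfolding char_def
    by (subst Bochner_Integration.integral_add, intro Bochner_Integration.integrable_diff i1 integrable_mult_right i, rule i,
        subst Bochner_Integration.integral_diff, rule i1, intro integrable_mult_right i, simp)
  also have "\<dots> = (CLINT x|\<mu>. iexp (u * x) * complex_of_real ((gauss_weight x)\<^sup>2))"
  proof (intro Bochner_Integration.integral_cong refl)
    fix x
    have "exp (- (sqrt 2 * x)\<^sup>2 / 2) = (exp (- x\<^sup>2 / 2))\<^sup>2"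
      by (simp add: power_mult_distrib power2_eq_square[of "exp _"] flip: exp_add)
    then show "iexp (u * x) - 2 * (iexp (u * x) * complex_of_real (exp (- (1 * x)\<^sup>2 / 2)))
      + iexp (u * x) * complex_of_real (exp (- (sqrt 2 * x)\<^sup>2 / 2)) = iexp (u * x) * complex_of_real ((gauss_weight x)\<^sup>2)"
      by (simp add: gauss_weight_def power2_eq_square algebra_simps)
  qed
  finally show ?thesis .
qed

lemma integrable_std_normal_quadratic:
  "integrable std_normal_distribution (\<lambda>z. a + b * z + c * z\<^sup>2 :: real)"
  using integrable_std_normal_distribution_moment[of 0] integrable_std_normal_distribution_moment[of 1]
    integrable_std_normal_distribution_moment[of 2]
  by (intro Bochner_Integration.integrable_add integrable_mult_right) (auto intro: integrable_mult_right[where c=a and f="\<lambda>_. 1", simplified])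

lemma integral_std_normal_quadratic:
  "(LINT z|std_normal_distribution. a + b * z + c * z\<^sup>2 :: real) = a + c"
proof -
  interpret N: real_distribution std_normal_distribution by (rule real_dist_normal_dist)
  have "(LINT z|std_normal_distribution. z :: real) = 0"
    using integral_std_normal_distribution_moment_odd[of 1] by simp
  moreover have "(LINT z|std_normal_distribution. z\<^sup>2 :: real) = 1"
    using std_normal_distribution_even_moments[of 1] by (simp add: fact_numeral)
  ultimately show ?thesis
    using integrable_std_normal_distribution_moment[of 1] integrable_std_normal_distribution_moment[of 2] N.prob_space
    by simp
qed

lemma levy_exponent_measurable:
  assumes "levy_measure \<nu>"
  shows "levy_exponent A \<nu> \<gamma> \<in> borel_measurable borel"
proof -
  interpret sigma_finite_measure \<nu> by (rule levy_measure_sigma_finite[OF assms])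
  have [measurable_cong]: "sets \<nu> = sets borel" using assms by (simp add: levy_measure_def)
  show ?thesis unfolding levy_exponent_def[abs_def] by measurable
qed

text \<open>Fubini, dominated by \<open>min 1 (x\<^sup>2) * (2 + (u + s * z)\<^sup>2)\<close>, which
  is integrable because the normal law has a second moment. The compensator is linear in the
  frequency and is therefore unchanged by the centred average.\<close>

lemma normal_average_levy_integral:
  fixes u s :: real
  assumes \<nu>: "levy_measure \<nu>"
  defines "j \<equiv> \<lambda>v x. iexp (v * x) - 1 - \<i> * complex_of_real (v * x * indicator {-1..1} x)"
  defines "k \<equiv> \<lambda>x. iexp (u * x) * complex_of_real (exp (- (s * x)\<^sup>2 / 2)) - 1 - \<i> * complex_of_real (u * x * indicator {-1..1} x)"
  shows "(CLINT z|std_normal_distribution. CLINT x|\<nu>. j (u + s * z) x) = (CLINT x|\<nu>. k x)"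
    and "integrable std_normal_distribution (\<lambda>z. CLINT x|\<nu>. j (u + s * z) x)"
    and "integrable \<nu> k"
proof -
  have [measurable_cong]: "sets \<nu> = sets borel" using \<nu> by (simp add: levy_measure_def)
  interpret \<nu>: sigma_finite_measure \<nu> by (rule levy_measure_sigma_finite[OF \<nu>])
  interpret N: real_distribution std_normal_distribution by (rule real_dist_normal_dist)
  interpret P: pair_sigma_finite \<nu> std_normal_distribution by unfold_locales
  have q: "integrable std_normal_distribution (\<lambda>z. 2 + (u + s * z)\<^sup>2)"
    using integrable_std_normal_quadratic[of "2 + u\<^sup>2" "2 * u * s" "s\<^sup>2"]
    by (simp add: power2_sum power_mult_distrib algebra_simps)
  have "integrable (\<nu> \<Otimes>\<^sub>M std_normal_distribution) (\<lambda>(x, z). min 1 (x\<^sup>2) * (2 + (u + s * z)\<^sup>2))"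
  proof (rule P.Fubini_integrable)
    show "(\<lambda>(x, z). min 1 (x\<^sup>2) * (2 + (u + s * z)\<^sup>2)) \<in> borel_measurable (\<nu> \<Otimes>\<^sub>M std_normal_distribution)"
      by measurable
    have "integrable \<nu> (\<lambda>x. min 1 (x\<^sup>2) * (LINT z|std_normal_distribution. 2 + (u + s * z)\<^sup>2))"
      by (intro integrable_mult_left levy_measure_integrable_min \<nu>)
    then show "integrable \<nu> (\<lambda>x. LINT z|std_normal_distribution. norm (case (x, z) of (x, z) \<Rightarrow> min 1 (x\<^sup>2) * (2 + (u + s * z)\<^sup>2)))"
      by (simp add: abs_mult abs_of_nonneg add_nonneg_nonneg)
    show "AE x in \<nu>. integrable std_normal_distribution (\<lambda>z. case (x, z) of (x, z) \<Rightarrow> min 1 (x\<^sup>2) * (2 + (u + s * z)\<^sup>2))"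
      using q by simp
  qed
  then have F: "integrable (\<nu> \<Otimes>\<^sub>M std_normal_distribution) (\<lambda>(x, z). j (u + s * z) x)"
  proof (rule Bochner_Integration.integrable_bound)
    show "(\<lambda>(x, z). j (u + s * z) x) \<in> borel_measurable (\<nu> \<Otimes>\<^sub>M std_normal_distribution)"
      unfolding j_def by measurable
    show "AE p in \<nu> \<Otimes>\<^sub>M std_normal_distribution. cmod (case p of (x, z) \<Rightarrow> j (u + s * z) x)
        \<le> norm (case p of (x, z) \<Rightarrow> min 1 (x\<^sup>2) * (2 + (u + s * z)\<^sup>2))"
    proof (rule AE_I2, clarify)
      fix x z :: real
      have "cmod (j (u + s * z) x) \<le> (2 + (u + s * z)\<^sup>2) * min 1 (x\<^sup>2)"
        unfolding j_def by (rule levy_integrand_bound)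
      then show "cmod (j (u + s * z) x) \<le> norm (min 1 (x\<^sup>2) * (2 + (u + s * z)\<^sup>2))"
        by (simp add: mult.commute abs_mult)
    qed
  qed
  have k: "(CLINT z|std_normal_distribution. j (u + s * z) x) = k x" for x
  proof -
    have i1: "integrable std_normal_distribution (\<lambda>z. iexp ((u + s * z) * x))"
      by (rule N.integrable_const_bound[where B=1]) auto
    have i2: "integrable std_normal_distribution (\<lambda>z. \<i> * complex_of_real ((u + s * z) * x * indicator {-1..1} x))"
      using integrable_std_normal_quadratic[of u s 0] by (intro integrable_mult_right integrable_of_real integrable_mult_left) simp
    have "(LINT z|std_normal_distribution. (u + s * z) * x * indicator {-1..1} x) = u * x * indicator {-1..1} x"
      using integral_std_normal_quadratic[of u s 0] by simp
    then have "(CLINT z|std_normal_distribution. \<i> * complex_of_real ((u + s * z) * x * indicator {-1..1} x)) = \<i> * complex_of_real (u * x * indicator {-1..1} x)"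
      by (subst integral_mult_right_zero, subst integral_complex_of_real) (simp only:)
    moreover have i0: "integrable std_normal_distribution (\<lambda>z. 1 :: complex)" "(CLINT z|std_normal_distribution. 1) = 1"
      using N.prob_space by auto
    ultimately show ?thesis
      unfolding j_def k_def
      by (simp only: Bochner_Integration.integral_diff[OF Bochner_Integration.integrable_diff[OF i1 i0(1)] i2]
          Bochner_Integration.integral_diff[OF i1 i0(1)] normal_average_iexp)
  qed
  show "(CLINT z|std_normal_distribution. CLINT x|\<nu>. j (u + s * z) x) = (CLINT x|\<nu>. k x)"
    using P.Fubini_integral[OF F] by (simp only: k)
  show "integrable std_normal_distribution (\<lambda>z. CLINT x|\<nu>. j (u + s * z) x)"
    using P.integrable_snd[OF F] by simp
  show "integrable \<nu> k"
    using P.integrable_fst[OF F] by (simp only: k)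
qed

lemma normal_average_levy_exponent:
  assumes \<nu>: "levy_measure \<nu>"
  shows "(CLINT z|std_normal_distribution. levy_exponent A \<nu> \<gamma> (u + s * z)) =
     \<i> * complex_of_real (\<gamma> * u) - complex_of_real (A * (u\<^sup>2 + s\<^sup>2) / 2) +
     (CLINT x|\<nu>. iexp (u * x) * complex_of_real (exp (- (s * x)\<^sup>2 / 2)) - 1 - \<i> * complex_of_real (u * x * indicator {-1..1} x))"
proof -
  have 1: "(LINT z|std_normal_distribution. \<gamma> * (u + s * z)) = \<gamma> * u"
    "integrable std_normal_distribution (\<lambda>z. \<gamma> * (u + s * z))"
    using integral_std_normal_quadratic[of "\<gamma> * u" "\<gamma> * s" 0] integrable_std_normal_quadratic[of "\<gamma> * u" "\<gamma> * s" 0]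
    by (simp_all add: algebra_simps)
  have *: "A * (u + s * z)\<^sup>2 / 2 = A * u\<^sup>2 / 2 + A * u * s * z + A * s\<^sup>2 / 2 * z\<^sup>2" for z
    by (simp add: power2_sum power_mult_distrib field_simps)
  have 2: "(LINT z|std_normal_distribution. A * (u + s * z)\<^sup>2 / 2) = A * (u\<^sup>2 + s\<^sup>2) / 2"
    "integrable std_normal_distribution (\<lambda>z. A * (u + s * z)\<^sup>2 / 2)"
    unfolding * using integral_std_normal_quadratic[of "A * u\<^sup>2 / 2" "A * u * s" "A * s\<^sup>2 / 2"] integrable_std_normal_quadratic[of "A * u\<^sup>2 / 2" "A * u * s" "A * s\<^sup>2 / 2"]
    by (simp_all add: field_simps)
  note 3 = normal_average_levy_integral[OF \<nu>, of u s]
  have i1: "integrable std_normal_distribution (\<lambda>z. \<i> * complex_of_real (\<gamma> * (u + s * z)))"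
    by (intro integrable_mult_right integrable_of_real 1)
  have i2: "integrable std_normal_distribution (\<lambda>z. complex_of_real (A * (u + s * z)\<^sup>2 / 2))"
    by (intro integrable_of_real 2)
  have e1: "(CLINT z|std_normal_distribution. \<i> * complex_of_real (\<gamma> * (u + s * z))) = \<i> * complex_of_real (\<gamma> * u)"
    by (subst integral_mult_right_zero, subst integral_complex_of_real, subst 1) (rule refl)
  have e2: "(CLINT z|std_normal_distribution. complex_of_real (A * (u + s * z)\<^sup>2 / 2)) = complex_of_real (A * (u\<^sup>2 + s\<^sup>2) / 2)"
    by (subst integral_complex_of_real, subst 2) (rule refl)
  show ?thesis
    unfolding levy_exponent_def
    by (subst Bochner_Integration.integral_add[OF Bochner_Integration.integrable_diff[OF i1 i2] 3(2)],
        subst Bochner_Integration.integral_diff[OF i1 i2]) (simp only: e1 e2 3(1))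
qed

text \<open>Averaging leaves the drift alone and turns the Gaussian part into an affine function of
  the variance \<open>s\<^sup>2\<close>. The second difference over the variances 0, 1, 2 removes
  both, together with the terms of the integrand that do not depend on s.\<close>

lemma second_average_levy_exponent:
  assumes \<nu>: "levy_measure \<nu>"
  shows "second_average (levy_exponent A \<nu> \<gamma>) u = (CLINT x|\<nu>. iexp (u * x) * complex_of_real ((gauss_weight x)\<^sup>2))"
proof -
  define k where "k s x = iexp (u * x) * complex_of_real (exp (- (s * x)\<^sup>2 / 2)) - 1 - \<i> * complex_of_real (u * x * indicator {-1..1} x)" for s x
  have k: "integrable \<nu> (k s)" for s
    unfolding k_def[abs_def] by (rule normal_average_levy_integral(3)[OF \<nu>])
  have k0: "levy_exponent A \<nu> \<gamma> u = \<i> * complex_of_real (\<gamma> * u) - complex_of_real (A * u\<^sup>2 / 2) + (CLINT x|\<nu>. k 0 x)"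
    by (simp add: levy_exponent_def k_def)
  have a: "(CLINT z|std_normal_distribution. levy_exponent A \<nu> \<gamma> (u + s * z)) =
     \<i> * complex_of_real (\<gamma> * u) - complex_of_real (A * (u\<^sup>2 + s\<^sup>2) / 2) + (CLINT x|\<nu>. k s x)" for s
    unfolding k_def by (rule normal_average_levy_exponent[OF \<nu>])
  have "second_average (levy_exponent A \<nu> \<gamma>) u = (CLINT x|\<nu>. k 0 x) - 2 * (CLINT x|\<nu>. k 1 x) + (CLINT x|\<nu>. k (sqrt 2) x)"
    unfolding second_average_def k0 a by (simp add: field_simps)
  also have "\<dots> = (CLINT x|\<nu>. k 0 x - 2 * k 1 x + k (sqrt 2) x)"
    by (subst Bochner_Integration.integral_add, intro Bochner_Integration.integrable_diff k integrable_mult_right, rule k,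
        subst Bochner_Integration.integral_diff, rule k, intro integrable_mult_right k, simp)
  also have "\<dots> = (CLINT x|\<nu>. iexp (u * x) * complex_of_real ((gauss_weight x)\<^sup>2))"
  proof (intro Bochner_Integration.integral_cong refl)
    fix x
    have "exp (- (sqrt 2 * x)\<^sup>2 / 2) = (exp (- x\<^sup>2 / 2))\<^sup>2"
      by (simp add: power_mult_distrib power2_eq_square[of "exp _"] flip: exp_add)
    then show "k 0 x - 2 * k 1 x + k (sqrt 2) x = iexp (u * x) * complex_of_real ((gauss_weight x)\<^sup>2)"
      by (simp add: gauss_weight_def k_def power2_eq_square algebra_simps)
  qed
  finally show ?thesis .
qed

section \<open>Small-time asymptotics of the increments\<close>

text \<open>Mean value inequality on a convex half-plane on which the derivative of exp has modulus
  at most 1.\<close>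

lemma cmod_exp_minus_one_le:
  assumes "Re w \<le> 0"
  shows "cmod (exp w - 1) \<le> cmod w"
proof -
  have "cmod (exp w - exp 0) \<le> 1 * cmod (w - 0)"
    by (rule field_differentiable_bound[where S="{z. Re z \<le> 0}" and f'=exp])
      (auto intro!: DERIV_subset[OF DERIV_exp] convex_halfspace_Re_le simp: assms)
  then show ?thesis by simp
qed

lemma scaled_exp_minus_one_tendsto:
  fixes z :: complex
  shows "(\<lambda>n. of_nat (Suc n) * (exp (complex_of_real (S / Suc n) * z) - 1)) \<longlonglongrightarrow> of_real S * z"
\<comment> \<open>The quotient (exp w - 1) / w used below requires nonzero w.\<close>
proof (cases "of_real S * z = 0")
  case True
  then have "complex_of_real (S / Suc n) * z = 0" for n by auto
  then show ?thesis using True by auto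
next
  case False
  define w where "w n = complex_of_real (S / Suc n) * z" for n
  have w0: "w n \<noteq> 0" for n using False by (auto simp: w_def simp del: of_nat_Suc)
  have "(\<lambda>n. S / Suc n) \<longlonglongrightarrow> 0"
    using tendsto_mult_left[OF LIMSEQ_inverse_real_of_nat, of S] by (simp add: divide_inverse)
  then have "w \<longlonglongrightarrow> of_real 0 * z"
    unfolding w_def by (intro tendsto_intros)
  then have "filterlim w (at 0) sequentially"
    using w0 by (auto simp: filterlim_at)
  from filterlim_compose[OF lim_exp_minus_1 this]
  have "(\<lambda>n. (exp (w n) - 1) / w n) \<longlonglongrightarrow> 1" .
  from tendsto_mult_left[OF this, of "of_real S * z"]
  have "(\<lambda>n. of_real S * z * ((exp (w n) - 1) / w n)) \<longlonglongrightarrow> of_real S * z" by simp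
  moreover have "of_real S * z * ((exp (w n) - 1) / w n) = of_nat (Suc n) * (exp (w n) - 1)" for n
    using False w0[of n] by (simp add: w_def field_simps del: of_nat_Suc)
  ultimately show ?thesis by (simp add: w_def)
qed

lemma levy_exponent_scaled:
  assumes \<mu>: "\<And>n. real_distribution (\<mu> n)"
    and ch: "\<And>n u. char (\<mu> n) u = exp (complex_of_real (S / Suc n) * levy_exponent A \<nu> \<gamma> u)"
    and S: "S > 0"
  shows "cmod (of_nat (Suc n) * (char (\<mu> n) u - 1)) \<le> S * cmod (levy_exponent A \<nu> \<gamma> u)"
    and "(\<lambda>n. of_nat (Suc n) * (char (\<mu> n) u - 1)) \<longlonglongrightarrow> of_real S * levy_exponent A \<nu> \<gamma> u"
proof -
  let ?\<psi> = "levy_exponent A \<nu> \<gamma> u"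
  \<comment> \<open>The index n = 0 is the time step S itself; a characteristic function has modulus
    at most 1, which forces the real part of the exponent to be nonpositive.\<close>
  have "exp (S * Re ?\<psi>) \<le> 1"
    using real_distribution.cmod_char_le_1[OF \<mu>, of 0 u] ch[of 0 u] by simp
  then have "Re ?\<psi> \<le> 0" using S by (simp add: mult_le_0_iff)
  then have "Re (complex_of_real (S / Suc n) * ?\<psi>) \<le> 0"
    using S by (simp add: mult_nonneg_nonpos divide_nonpos_pos del: of_nat_Suc)
  from cmod_exp_minus_one_le[OF this]
  have "cmod (char (\<mu> n) u - 1) \<le> S / Suc n * cmod ?\<psi>"
    using S unfolding ch norm_mult norm_of_real by (simp del: of_nat_Suc)
  then have "real (Suc n) * cmod (char (\<mu> n) u - 1) \<le> S * cmod ?\<psi>"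
    by (simp add: field_simps del: of_nat_Suc)
  then show "cmod (of_nat (Suc n) * (char (\<mu> n) u - 1)) \<le> S * cmod ?\<psi>"
    by (simp add: norm_mult del: of_nat_Suc)
  show "(\<lambda>n. of_nat (Suc n) * (char (\<mu> n) u - 1)) \<longlonglongrightarrow> of_real S * ?\<psi>"
    unfolding ch by (rule scaled_exp_minus_one_tendsto)
qed

text \<open>The weights 1, -2, 1 sum to 0, so subtracting a constant changes nothing. The subtracted
  1 keeps the scaled functions bounded uniformly in the number of steps, as dominated convergence
  requires.\<close>

lemma second_average_scaled:
  assumes "real_distribution \<mu>"
  shows "second_average (\<lambda>u. of_nat k * (char \<mu> u - 1)) u = of_nat k * second_average (char \<mu>) u"
proof -
  interpret \<mu>: real_distribution \<mu> by fact
  interpret N: real_distribution std_normal_distribution by (rule real_dist_normal_dist)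
  have i: "integrable std_normal_distribution (\<lambda>z. char \<mu> (u + s * z))" for s
    by (rule N.integrable_const_bound[where B=1]) (auto simp: \<mu>.cmod_char_le_1)
  have "(CLINT z|std_normal_distribution. of_nat k * (char \<mu> (u + s * z) - 1)) =
      of_nat k * ((CLINT z|std_normal_distribution. char \<mu> (u + s * z)) - 1)" for s
    using N.prob_space by (subst integral_mult_right_zero, subst Bochner_Integration.integral_diff[OF i]) auto
  then show ?thesis by (simp only: second_average_def) (simp add: algebra_simps)
qed

lemma second_average_scaled_tendsto:
  assumes \<nu>: "levy_measure \<nu>"
    and \<mu>: "\<And>n. real_distribution (\<mu> n)"
    and ch: "\<And>n u. char (\<mu> n) u = exp (complex_of_real (S / Suc n) * levy_exponent A \<nu> \<gamma> u)"
    and S: "S > 0"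
  shows "(\<lambda>n. of_nat (Suc n) * second_average (char (\<mu> n)) u) \<longlonglongrightarrow> of_real S * second_average (levy_exponent A \<nu> \<gamma>) u"
proof -
  let ?\<psi> = "levy_exponent A \<nu> \<gamma>"
  let ?g = "\<lambda>n u. of_nat (Suc n) * (char (\<mu> n) u - 1)"
  note sc = levy_exponent_scaled[OF \<mu> ch S]
  obtain B where B: "\<And>u. cmod (?\<psi> u) \<le> B * (1 + u\<^sup>2)" using levy_exponent_bound[OF \<nu>] by blast
  have [measurable]: "?\<psi> \<in> borel_measurable borel" by (rule levy_exponent_measurable[OF \<nu>])
  have [measurable]: "char (\<mu> n) \<in> borel_measurable borel" for n
    by (rule real_distribution.char_measurable[OF \<mu>])
  have lim: "(\<lambda>n. CLINT z|std_normal_distribution. ?g n (u + s * z)) \<longlonglongrightarrow> (CLINT z|std_normal_distribution. of_real S * ?\<psi> (u + s * z))" for s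
  proof (rule integral_dominated_convergence)
    show "integrable std_normal_distribution (\<lambda>z. S * (B * (1 + (u + s * z)\<^sup>2)))"
      using integrable_std_normal_quadratic[of "1 + u\<^sup>2" "2 * u * s" "s\<^sup>2"]
      by (intro integrable_mult_right) (simp add: power2_sum power_mult_distrib algebra_simps)
    show "AE z in std_normal_distribution. cmod (?g n (u + s * z)) \<le> S * (B * (1 + (u + s * z)\<^sup>2))" for n
      using sc(1) B S by (intro AE_I2 order_trans[OF sc(1)] mult_left_mono) auto
  qed (use sc(2) in auto)
  have "(\<lambda>n. second_average (?g n) u) \<longlonglongrightarrow> of_real S * ?\<psi> u
      - 2 * (CLINT z|std_normal_distribution. of_real S * ?\<psi> (u + 1 * z)) + (CLINT z|std_normal_distribution. of_real S * ?\<psi> (u + sqrt 2 * z))"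
    unfolding second_average_def by (intro tendsto_intros lim sc(2))
  also have "of_real S * ?\<psi> u
      - 2 * (CLINT z|std_normal_distribution. of_real S * ?\<psi> (u + 1 * z)) + (CLINT z|std_normal_distribution. of_real S * ?\<psi> (u + sqrt 2 * z))
     = of_real S * second_average ?\<psi> u"
    by (simp only: second_average_def integral_mult_right_zero) (simp add: algebra_simps)
  finally show ?thesis by (simp only: second_average_scaled[OF \<mu>])
qed

text \<open>After multiplication by the squared weight, the scaled laws and the Levy measure become
  finite measures whose Fourier transforms are second averages, and these converge. Dividing the
  test function by the same weight stays bounded and continuous because it vanishes near 0.\<close>

lemma levy_small_time_limit:
  fixes f :: "real \<Rightarrow> real"
  assumes \<nu>: "levy_measure \<nu>"
    and \<mu>: "\<And>n. real_distribution (\<mu> n)"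
    and ch: "\<And>n u. char (\<mu> n) u = exp (complex_of_real (S / Suc n) * levy_exponent A \<nu> \<gamma> u)"
    and S: "S > 0"
    and f: "\<And>x. isCont f x" "\<And>x. \<bar>f x\<bar> \<le> B"
    and \<delta>: "\<delta> > 0" "\<And>x. \<bar>x\<bar> < \<delta> \<Longrightarrow> f x = 0"
  shows "(\<lambda>n. real (Suc n) * (LINT x|\<mu> n. f x)) \<longlonglongrightarrow> S * (LINT x|\<nu>. f x)"
proof -
  let ?w = "\<lambda>x. (gauss_weight x)\<^sup>2"
  \<comment> \<open>At 0 the quotient is 0 / 0 = 0, which agrees with its value on the whole
    neighbourhood where f vanishes.\<close>
  define b where "b x = f x / ?w x" for x
  have [measurable_cong]: "sets \<nu> = sets borel" using \<nu> by (simp add: levy_measure_def)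
  have sp\<nu>: "space \<nu> = UNIV" by (metis sets_eq_imp_space_eq \<open>sets \<nu> = sets borel\<close> space_borel)
  interpret \<mu>: real_distribution "\<mu> n" for n by (rule \<mu>)
  have [measurable]: "f \<in> borel_measurable borel"
    using f(1) by (simp add: borel_measurable_continuous_onI continuous_at_imp_continuous_on)
  have w0: "gauss_weight x \<noteq> 0" if "x \<noteq> 0" for x
    using min_le_gauss_weight[of x] that by (auto simp: min_def split: if_splits)
  have fb: "f x = ?w x * b x" for x
    using w0[of x] \<delta> by (cases "x = 0") (auto simp: b_def)
  have cont: "isCont b x" for x
  proof (cases "x = 0")
    case True
    have "eventually (\<lambda>y. b y = 0) (nhds x)"
      using \<delta> True by (auto simp: eventually_nhds_metric b_def dist_real_def intro!: exI[of _ \<delta>])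
    then show ?thesis by (subst isCont_cong) auto
  next
    case False
    then show ?thesis unfolding b_def gauss_weight_def using w0[OF False] f(1)
      by (intro continuous_intros) (auto simp: gauss_weight_def)
  qed
  \<comment> \<open>Away from the \<delta>-neighbourhood the weight is at least
    \<open>min 1 (\<delta>\<^sup>2) / 3\<close>.\<close>
  have bb: "\<bar>b x\<bar> \<le> B / (min 1 (\<delta>\<^sup>2) / 3)\<^sup>2" for x
  proof (cases "\<bar>x\<bar> < \<delta>")
    case True
    have "B \<ge> 0" using f(2)[of 0] by linarith
    then show ?thesis using True \<delta> by (simp add: b_def)
  next
    case False
    then have "\<delta>\<^sup>2 \<le> x\<^sup>2" using \<delta>(1) by (simp add: abs_le_square_iff[symmetric])
    then have "min 1 (\<delta>\<^sup>2) / 3 \<le> gauss_weight x" using min_le_gauss_weight[of x] by linarith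
    then have "(min 1 (\<delta>\<^sup>2) / 3)\<^sup>2 \<le> ?w x" using \<delta>(1) by (intro power_mono) auto
    moreover have "0 < min 1 (\<delta>\<^sup>2)" using \<delta>(1) by simp
    then have "0 < (min 1 (\<delta>\<^sup>2) / 3)\<^sup>2" by (intro zero_less_power) simp
    ultimately show ?thesis unfolding b_def abs_divide using f(2)[of x]
      by (intro frac_le) auto
  qed
  have ws: "?w x \<le> min 1 (x\<^sup>2)" for x
  proof -
    have "?w x \<le> 1 * gauss_weight x" unfolding power2_eq_square
      using gauss_weight_le[of x] gauss_weight_nonneg[of x] by (intro mult_right_mono) auto
    then show ?thesis using gauss_weight_le[of x] by linarith
  qed
  have iw: "integrable \<nu> ?w"
    by (rule Bochner_Integration.integrable_bound[OF levy_measure_integrable_min[OF \<nu>]]) (use ws in auto)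
  let ?M = "\<lambda>n. density (\<mu> n) (\<lambda>x. real (Suc n) * ?w x)"
  let ?N = "density \<nu> (\<lambda>x. S * ?w x)"
  have fin: "finite_measure (density K (\<lambda>x. ennreal (c * ?w x)))"
    if "integrable K ?w" "sets K = sets borel" "c \<ge> 0" for K c
  proof (rule finite_measureI)
    have [measurable_cong]: "sets K = sets borel" by fact
    have "emeasure (density K (\<lambda>x. ennreal (c * ?w x))) (space K) = (\<integral>\<^sup>+x. ennreal (c * ?w x) \<partial>K)"
      by (subst emeasure_density) (auto intro!: nn_integral_cong)
    also have "\<dots> < \<infinity>"
      using integrable_mult_right[of c, OF that(1)] that(3) by (subst nn_integral_eq_integral) auto
    finally show "emeasure (density K (\<lambda>x. ennreal (c * ?w x))) (space (density K (\<lambda>x. ennreal (c * ?w x)))) \<noteq> \<infinity>"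
      by simp
  qed
  have "(\<lambda>n. LINT x|?M n. b x) \<longlonglongrightarrow> (LINT x|?N. b x)"
  proof (rule finite_measure_levy_continuity[OF _ _ _ _ _ cont bb])
    show "finite_measure (?M n)" for n
    proof (rule fin)
      show "integrable (\<mu> n) ?w"
        by (rule \<mu>.integrable_const_bound[where B=1]) (use ws in \<open>auto simp: min_le_iff_disj\<close>)
    qed auto
    show "finite_measure ?N" using S by (intro fin iw) (simp_all add: \<open>sets \<nu> = sets borel\<close>)
    show "sets (?M n) = sets borel" "sets ?N = sets borel" for n
      by (simp_all add: \<open>sets \<nu> = sets borel\<close>)
    show "(\<lambda>n. CLINT x|?M n. iexp (u * x)) \<longlonglongrightarrow> (CLINT x|?N. iexp (u * x))" for u
    proof -
      have "(CLINT x|density K (\<lambda>x. ennreal (c * ?w x)). iexp (u * x)) = of_real c * (CLINT x|K. iexp (u * x) * complex_of_real (?w x))"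
        if "sets K = sets borel" "c \<ge> 0" for K c
      proof -
        have [measurable_cong]: "sets K = sets borel" by fact
        show ?thesis using that(2)
          by (subst integral_density) (auto simp: scaleR_conv_of_real ac_simps simp flip: integral_mult_right_zero)
      qed
      note * = this
      have "(CLINT x|?M n. iexp (u * x)) = of_nat (Suc n) * second_average (char (\<mu> n)) u" for n
        unfolding second_average_char[OF \<mu>] by (subst *) auto
      moreover have "(CLINT x|?N. iexp (u * x)) = of_real S * second_average (levy_exponent A \<nu> \<gamma>) u"
        unfolding second_average_levy_exponent[OF \<nu>] by (intro *) (simp_all add: \<open>sets \<nu> = sets borel\<close> S less_imp_le)
      ultimately show ?thesis using second_average_scaled_tendsto[OF \<nu> \<mu> ch S, of u] by simp
    qed
  qed
  moreover have "b \<in> borel_measurable borel" unfolding b_def by measurable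
  then have "(LINT x|?M n. b x) = real (Suc n) * (LINT x|\<mu> n. f x)" for n
    by (subst integral_density) (auto simp: mult.assoc simp del: of_nat_Suc simp flip: fb)
  moreover have "(LINT x|?N. b x) = S * (LINT x|\<nu>. f x)"
    using \<open>b \<in> borel_measurable borel\<close> S by (subst integral_density) (auto simp: mult.assoc simp flip: fb)
  ultimately show ?thesis by simp
qed

text \<open>Bounded substitutes for the mean and the second moment of an increment, neither of which
  need exist. The first is the imaginary part of the characteristic function at 1. The second is at
  most three times the mean of \<open>gauss_weight\<close>, which is one minus a Gaussian average of
  the characteristic function.\<close>

lemma levy_small_time_bounds:
  assumes \<nu>: "levy_measure \<nu>"
    and \<mu>: "\<And>n. real_distribution (\<mu> n)"
    and ch: "\<And>n u. char (\<mu> n) u = exp (complex_of_real (S / Suc n) * levy_exponent A \<nu> \<gamma> u)"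
    and S: "S > 0"
  shows "\<exists>C. \<forall>n. real (Suc n) * \<bar>LINT x|\<mu> n. sin x\<bar> \<le> C \<and> real (Suc n) * (LINT x|\<mu> n. min 1 (x\<^sup>2)) \<le> C"
proof -
  let ?\<psi> = "levy_exponent A \<nu> \<gamma>"
  obtain B where B: "\<And>u. cmod (?\<psi> u) \<le> B * (1 + u\<^sup>2)" using levy_exponent_bound[OF \<nu>] by blast
  note sc = levy_exponent_scaled[OF \<mu> ch S]
  have drift: "real (Suc n) * \<bar>LINT x|\<mu> n. sin x\<bar> \<le> S * cmod (?\<psi> 1)" for n
  proof -
    interpret \<mu>: real_distribution "\<mu> n" by (rule \<mu>)
    have "integrable (\<mu> n) (\<lambda>x. iexp (1 * x))"
      by (rule \<mu>.integrable_const_bound[where B=1]) auto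
    then have "Im (char (\<mu> n) 1) = (LINT x|\<mu> n. Im (iexp (1 * x)))"
      unfolding char_def by (rule integral_Im[symmetric])
    then have "(LINT x|\<mu> n. sin x) = Im (char (\<mu> n) 1 - 1)" by (simp add: Im_exp)
    then have "\<bar>LINT x|\<mu> n. sin x\<bar> \<le> cmod (char (\<mu> n) 1 - 1)" using abs_Im_le_cmod by metis
    then have "real (Suc n) * \<bar>LINT x|\<mu> n. sin x\<bar> \<le> real (Suc n) * cmod (char (\<mu> n) 1 - 1)"
      by (rule mult_left_mono) simp
    also have "\<dots> \<le> S * cmod (?\<psi> 1)" using sc(1)[of n 1] by (simp add: norm_mult del: of_nat_Suc)
    finally show ?thesis .
  qed
  have second: "real (Suc n) * (LINT x|\<mu> n. min 1 (x\<^sup>2)) \<le> 3 * (S * (2 * B))" for n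
  proof -
    interpret \<mu>: real_distribution "\<mu> n" by (rule \<mu>)
    interpret N: real_distribution std_normal_distribution by (rule real_dist_normal_dist)
    have ie: "integrable (\<mu> n) (\<lambda>x. exp (- x\<^sup>2 / 2))"
      by (rule \<mu>.integrable_const_bound[where B=1]) auto
    have ig: "integrable (\<mu> n) gauss_weight"
      unfolding gauss_weight_def by (intro Bochner_Integration.integrable_diff ie) simp
    have ic: "integrable std_normal_distribution (char (\<mu> n))"
      by (rule N.integrable_const_bound[where B=1]) (auto simp: \<mu>.cmod_char_le_1)
    have "(CLINT z|std_normal_distribution. char (\<mu> n) z) = complex_of_real (LINT x|\<mu> n. exp (- x\<^sup>2 / 2))"
      using normal_average_char[OF \<mu>[of n], of 0 1] by simp
    moreover have "(LINT x|\<mu> n. gauss_weight x) = 1 - (LINT x|\<mu> n. exp (- x\<^sup>2 / 2))"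
      unfolding gauss_weight_def using ie \<mu>.prob_space by (subst Bochner_Integration.integral_diff) auto
    ultimately have "complex_of_real (LINT x|\<mu> n. gauss_weight x) = - (CLINT z|std_normal_distribution. char (\<mu> n) z - 1)"
      using ic N.prob_space by (subst Bochner_Integration.integral_diff) auto
    then have "of_nat (Suc n) * complex_of_real (LINT x|\<mu> n. gauss_weight x) = - (CLINT z|std_normal_distribution. of_nat (Suc n) * (char (\<mu> n) z - 1))"
      by (simp only: integral_mult_right_zero) (simp del: of_nat_Suc)
    then have "cmod (of_nat (Suc n) * complex_of_real (LINT x|\<mu> n. gauss_weight x)) = cmod (CLINT z|std_normal_distribution. of_nat (Suc n) * (char (\<mu> n) z - 1))"
      by (simp only: norm_minus_cancel)
    moreover have "(LINT x|\<mu> n. gauss_weight x) \<ge> 0" by (intro integral_nonneg_AE) (simp add: gauss_weight_nonneg)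
    ultimately have "real (Suc n) * (LINT x|\<mu> n. gauss_weight x) = cmod (CLINT z|std_normal_distribution. of_nat (Suc n) * (char (\<mu> n) z - 1))"
      by (simp add: norm_mult del: of_nat_Suc)
    also have "\<dots> \<le> (LINT z|std_normal_distribution. S * B + 0 * z + (S * B) * z\<^sup>2)"
    proof (rule Bochner_Integration.integral_norm_bound_integral)
      show "integrable std_normal_distribution (\<lambda>z. of_nat (Suc n) * (char (\<mu> n) z - 1))"
        by (intro integrable_mult_right Bochner_Integration.integrable_diff ic) simp
      fix z
      have "S * cmod (?\<psi> z) \<le> S * (B * (1 + z\<^sup>2))" using B S by simp
      then show "cmod (of_nat (Suc n) * (char (\<mu> n) z - 1)) \<le> S * B + 0 * z + S * B * z\<^sup>2"
        using sc(1)[of n z] by (simp add: algebra_simps)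
    qed (rule integrable_std_normal_quadratic)
    also have "\<dots> = S * (2 * B)" by (subst integral_std_normal_quadratic) simp
    finally have G: "real (Suc n) * (LINT x|\<mu> n. gauss_weight x) \<le> S * (2 * B)" .
    have "(LINT x|\<mu> n. min 1 (x\<^sup>2)) \<le> (LINT x|\<mu> n. 3 * gauss_weight x)"
    proof (rule integral_mono)
      show "integrable (\<mu> n) (\<lambda>x. min 1 (x\<^sup>2))" by (rule \<mu>.integrable_const_bound[where B=1]) auto
      show "integrable (\<mu> n) (\<lambda>x. 3 * gauss_weight x)" by (intro integrable_mult_right ig)
    qed (rule min_le_gauss_weight)
    then have "real (Suc n) * (LINT x|\<mu> n. min 1 (x\<^sup>2)) \<le> real (Suc n) * (LINT x|\<mu> n. 3 * gauss_weight x)"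
      by (intro mult_left_mono) auto
    also have "\<dots> = 3 * (real (Suc n) * (LINT x|\<mu> n. gauss_weight x))" by simp
    finally show ?thesis using G by linarith
  qed
  show ?thesis
    using drift second
    by (intro exI[of _ "max (S * cmod (?\<psi> 1)) (3 * (S * (2 * B)))"]) (auto simp: le_max_iff_disj)
qed

section \<open>The play operator\<close>

text \<open>Here \<open>y\<close> lists the increments of the sampled path, and the residual is
  sample minus lazy path. The lazy path is thus the partial sum of \<open>y\<close> minus the
  residual.\<close>

primrec play_residual :: "real \<Rightarrow> (nat \<Rightarrow> real) \<Rightarrow> nat \<Rightarrow> real" where
  "play_residual c y 0 = 0"
| "play_residual c y (Suc k) = max (- (c / 2)) (min (play_residual c y k + y k) (c / 2))"

text \<open>The summand is what the clamp cuts off, which is the distance moved by the lazy path in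
  this step.\<close>

primrec play_variation :: "real \<Rightarrow> (nat \<Rightarrow> real) \<Rightarrow> nat \<Rightarrow> real" where
  "play_variation c y 0 = 0"
| "play_variation c y (Suc k) =
    play_variation c y k + \<bar>play_residual c y k + y k - play_residual c y (Suc k)\<bar>"

text \<open>The Huber function has slope \<open>1\<close> exactly where the play moves, so that \<open>V + huber c d\<close> changes by
  a smooth function of the increment, without any case distinction (lemma \<open>huber_play_step\<close>).\<close>

definition huber :: "real \<Rightarrow> real \<Rightarrow> real" where
  "huber c z = (if \<bar>z\<bar> \<le> c / 2 then z\<^sup>2 / c else \<bar>z\<bar> - c / 4)"

lemma play_cong:
  assumes "\<And>i. i < k \<Longrightarrow> y i = y' i"
  shows "play_residual c y k = play_residual c y' k" "play_variation c y k = play_variation c y' k"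
  using assms by (induction k) auto

lemma abs_play_residual_le: "c > 0 \<Longrightarrow> \<bar>play_residual c y k\<bar> \<le> c / 2"
proof (cases k)
  case (Suc n)
  assume "c > 0"
  then show ?thesis unfolding Suc play_residual.simps by linarith
qed simp

lemma play_variation_nonneg: "0 \<le> play_variation c y k"
  by (induction k) auto

lemma huber_nonneg: "c > 0 \<Longrightarrow> 0 \<le> huber c z"
  by (auto simp: huber_def)

lemma huber_le: "c > 0 \<Longrightarrow> huber c z \<le> z\<^sup>2 / c"
  using zero_le_power2[of "\<bar>z\<bar> - c / 2"]
  by (auto simp: huber_def power2_diff field_simps power2_eq_square)

text \<open>Beyond c / 2 the function equals its threshold value c / 4 plus the distance to the
  clamping interval, and this distance is the move of the play.\<close>

lemma huber_clamp:
  assumes "c > 0"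
  shows "huber c z = huber c (max (- (c / 2)) (min z (c / 2))) + \<bar>z - max (- (c / 2)) (min z (c / 2))\<bar>"
proof -
  consider "z < - (c / 2)" | "\<bar>z\<bar> \<le> c / 2" | "z > c / 2" by linarith
  then show ?thesis
    by cases (use assms in \<open>auto simp: huber_def power2_eq_square field_simps max_def min_def\<close>)
qed

text \<open>If d + y stays in the quadratic zone, the difference of squares factors with one factor
  at most c. Otherwise the linear branch, being tangent to the parabola, lies below it at d.\<close>

lemma huber_lipschitz:
  assumes "c > 0" "\<bar>d\<bar> \<le> c / 2"
  shows "huber c (d + y) \<le> huber c d + \<bar>y\<bar>"
proof (cases "\<bar>d + y\<bar> \<le> c / 2")
  case True
  have "(d + y)\<^sup>2 - d\<^sup>2 = y * (d + y + d)" by (simp add: power2_eq_square algebra_simps)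
  also have "\<dots> \<le> \<bar>y\<bar> * \<bar>d + y + d\<bar>" by (metis abs_ge_self abs_mult)
  also have "\<bar>d + y + d\<bar> \<le> c" using True assms by linarith
  then have "\<bar>y\<bar> * \<bar>d + y + d\<bar> \<le> \<bar>y\<bar> * c" by (rule mult_left_mono) simp
  finally show ?thesis using True assms by (simp add: huber_def field_simps)
next
  case False
  have "(\<bar>d\<bar> - c / 2)\<^sup>2 \<ge> 0" by simp
  then have "\<bar>d\<bar> - c / 4 \<le> d\<^sup>2 / c" using assms(1)
    by (simp add: power2_diff field_simps power2_eq_square)
  then show ?thesis using False assms by (simp add: huber_def)
qed

lemma huber_play_step:
  assumes "c > 0"
  shows "play_variation c y (Suc k) + huber c (play_residual c y (Suc k)) = play_variation c y k + huber c (play_residual c y k + y k)"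
  using huber_clamp[OF assms, of "play_residual c y k + y k"] by simp

lemma play_variation_mono: "j \<le> k \<Longrightarrow> play_variation c y j \<le> play_variation c y k"
  by (rule lift_Suc_mono_le[of "play_variation c y"]) auto

text \<open>The lazy path is within c / 2 of the samples at both ends, so its own increment misses
  at most c.\<close>

lemma truncated_increment_le_play_variation:
  assumes "c > 0" "j \<le> k"
  shows "max (\<bar>(\<Sum>i<k. y i) - (\<Sum>i<j. y i)\<bar> - c) 0 \<le> play_variation c y k - play_variation c y j"
proof -
  \<comment> \<open>Each bracket is a position of the lazy path.\<close>
  have "\<bar>((\<Sum>i<k. y i) - play_residual c y k) - ((\<Sum>i<j. y i) - play_residual c y j)\<bar> \<le> play_variation c y k - play_variation c y j"
    using assms(2) by (induction k rule: dec_induct) (auto simp del: play_residual.simps)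
  then show ?thesis
    using abs_play_residual_le[OF assms(1), of y k] abs_play_residual_le[OF assms(1), of y j]
      play_variation_mono[OF assms(2), of c y] by (simp add: max_def) linarith
qed

text \<open>The increment bounds telescope along \<open>idx\<close>; moves of the play before
  \<open>idx 0\<close> and after \<open>idx n\<close> only add.\<close>

lemma truncated_variation_le_play_variation:
  assumes "c > 0" "\<And>i. i < n \<Longrightarrow> idx i \<le> idx (Suc i)" "idx n \<le> k"
  shows "(\<Sum>i\<in>{1..n}. max (\<bar>(\<Sum>j<idx i. y j) - (\<Sum>j<idx (i - 1). y j)\<bar> - c) 0) \<le> play_variation c y k"
proof -
  have "(\<Sum>i\<in>{1..n}. max (\<bar>(\<Sum>j<idx i. y j) - (\<Sum>j<idx (i - 1). y j)\<bar> - c) 0)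
      \<le> play_variation c y (idx n) - play_variation c y (idx 0)"
    using assms(2)
  proof (induction n)
    case (Suc n)
    then show ?case
      using truncated_increment_le_play_variation[OF assms(1) Suc.prems[of n], of y] by force
  qed simp
  then show ?thesis
    using play_variation_nonneg[of c y "idx 0"] play_variation_mono[OF assms(3), of c y] by linarith
qed

section \<open>One-step exponential estimate\<close>

lemma abs_sin_minus_le: "\<bar>sin x - x\<bar> \<le> x\<^sup>2" for x :: real
proof -
  have "cmod (iexp x - (\<Sum>k\<le>1. (\<i> * x) ^ k / fact k)) \<le> \<bar>x\<bar> ^ (Suc 1) / fact (Suc 1)"
    using iexp_approx1[of x 1] by simp
  then have "\<bar>Im (iexp x - (\<Sum>k\<le>1. (\<i> * x) ^ k / fact k))\<bar> \<le> \<bar>x\<bar> ^ (Suc 1) / fact (Suc 1)"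
    by (rule order_trans[OF abs_Im_le_cmod])
  then have "\<bar>sin x - x\<bar> \<le> x\<^sup>2 / 2" by (simp add: Im_exp power2_eq_square)
  also have "\<dots> \<le> x\<^sup>2" by simp
  finally show ?thesis .
qed

text \<open>The linear term keeps coefficient exactly 1, so that its small mean can be exploited
  after integration; everything else is quadratic.\<close>

lemma exp_le_quadratic: "exp q \<le> 1 + q + q\<^sup>2 * exp \<bar>q\<bar>" for q :: real
proof -
  have "1 + (- q) \<le> exp (- q)" by (rule exp_ge_add_one_self)
  then have "(1 - q) * exp q \<le> exp (- q) * exp q" by (intro mult_right_mono) auto
  then have 1: "exp q \<le> 1 + q * exp q" by (simp add: algebra_simps flip: exp_add)
  have "q * (exp q - 1) \<le> q * (q * exp \<bar>q\<bar>)"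
  proof (cases "q \<ge> 0")
    case True
    then show ?thesis using 1 by (intro mult_left_mono) auto
  next
    case False
    have "q * exp \<bar>q\<bar> \<le> q * 1" using False by (intro mult_left_mono_neg) auto
    also have "\<dots> \<le> exp q - 1" using exp_ge_add_one_self[of q] by linarith
    finally show ?thesis using False by (intro mult_left_mono_neg) auto
  qed
  then show ?thesis using 1 by (simp add: power2_eq_square algebra_simps)
qed

text \<open>The exponential growth caused by a jump beyond that of a jump of size 1. The cap m makes
  it bounded, and for m at least 1 it is continuous and vanishes on [-1, 1], as
  \<open>levy_small_time_limit\<close> demands.\<close>

definition exp_excess :: "real \<Rightarrow> real \<Rightarrow> real \<Rightarrow> real" where
  "exp_excess \<alpha> m y = exp (\<alpha> * min (max \<bar>y\<bar> 1) m) - exp \<alpha>"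

text \<open>The coefficient \<open>b\<close> depends on the state d and v but not on y, so
  integration turns its term into a multiple of the mean of \<open>sin\<close>. For small y,
  \<open>K\<close> collects \<alpha> for replacing y by \<open>sin y\<close>, \<alpha> / c for the
  quadratic part of the Huber function, and the remainder of exp. For large y, \<alpha> pays for the
  sine term and \<open>exp \<alpha>\<close> for the part of the jump up to size 1.\<close>

lemma huber_exp_step:
  fixes \<alpha> c m :: real
  assumes \<alpha>: "\<alpha> > 0" and c: "c > 0" and m: "m \<ge> 1" and d: "\<bar>d\<bar> \<le> c / 2" and v: "v \<ge> 0"
  defines "K \<equiv> 2 * \<alpha> + \<alpha> / c + (\<alpha> * (1 + 1 / c))\<^sup>2 * exp (\<alpha> * (1 + 1 / c)) + exp \<alpha>"
  shows "\<exists>b. \<bar>b\<bar> \<le> 1 \<and> (\<forall>y. exp (\<alpha> * min (v + huber c (d + y)) m) \<le>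
     exp (\<alpha> * min (v + huber c d) m) * (1 + \<alpha> * b * sin y + K * min 1 (y\<^sup>2) + exp_excess \<alpha> m y))"
proof -
  \<comment> \<open>Once the cap is reached the capped potential cannot grow, so the slope is 0.
    Before that it is 2 * d / c, the derivative of the Huber function at d.\<close>
  define s :: real where "s = (if v + huber c d < m then 1 else 0)"
  define b where "b = s * (2 * d / c)"
  define Q where "Q = \<alpha> * (1 + 1 / c)"
  have s: "s = 0 \<or> s = 1" by (auto simp: s_def)
  have "\<bar>2 * d / c\<bar> \<le> 1" using c d by (simp add: abs_mult field_simps)
  then have b: "\<bar>b\<bar> \<le> 1" using s by (auto simp: b_def)
  have Q: "Q > 0" using \<alpha> c by (auto simp: Q_def intro!: mult_pos_pos add_pos_pos)
  have K0: "K * t \<ge> 0" if "t \<ge> 0" for t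
    using \<alpha> c that by (auto simp: K_def intro!: mult_nonneg_nonneg add_nonneg_nonneg)
  have "exp (\<alpha> * (min (v + huber c (d + y)) m - min (v + huber c d) m))
      \<le> 1 + \<alpha> * b * sin y + K * min 1 (y\<^sup>2) + exp_excess \<alpha> m y" (is "exp (\<alpha> * ?p) \<le> _") for y
  proof (cases "\<bar>y\<bar> \<le> 1")
    case True
    have y2: "y\<^sup>2 \<le> \<bar>y\<bar>" using mult_left_mono[OF True, of "\<bar>y\<bar>"] by (simp add: power2_eq_square)
    have y1: "min 1 (y\<^sup>2) = y\<^sup>2" using True by (simp add: min_absorb2 abs_square_le_1)
    have "exp_excess \<alpha> m y = 0" using True m by (simp add: exp_excess_def)
    have "huber c (d + y) \<le> (d + y)\<^sup>2 / c" by (rule huber_le[OF c])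
    also have "\<dots> = huber c d + 2 * d / c * y + y\<^sup>2 / c"
      using c d by (simp add: huber_def power2_sum add_divide_distrib)
    finally have h: "huber c (d + y) - huber c d \<le> 2 * d / c * y + y\<^sup>2 / c" by simp
    have "?p \<le> s * (huber c (d + y) - huber c d)" by (auto simp: s_def)
    also have "\<dots> \<le> s * (2 * d / c * y + y\<^sup>2 / c)" using h s by (intro mult_left_mono) auto
    also have "\<dots> \<le> b * y + y\<^sup>2 / c" using s c by (auto simp: b_def)
    finally have "\<alpha> * ?p \<le> \<alpha> * (b * y + y\<^sup>2 / c)" using \<alpha> by (intro mult_left_mono) auto
    moreover define q where "q = \<alpha> * (b * y + y\<^sup>2 / c)"
    ultimately have "exp (\<alpha> * ?p) \<le> exp q" by simp
    also have "\<dots> \<le> 1 + q + q\<^sup>2 * exp \<bar>q\<bar>" by (rule exp_le_quadratic)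
    also have "q\<^sup>2 * exp \<bar>q\<bar> \<le> (Q\<^sup>2 * y\<^sup>2) * exp Q"
    proof -
      have "\<bar>b * y + y\<^sup>2 / c\<bar> \<le> \<bar>b * y\<bar> + \<bar>y\<^sup>2 / c\<bar>" by (rule abs_triangle_ineq)
      also have "\<bar>b * y\<bar> \<le> \<bar>y\<bar>" using mult_right_mono[OF b, of "\<bar>y\<bar>"] by (simp add: abs_mult)
      also have "\<bar>y\<^sup>2 / c\<bar> \<le> \<bar>y\<bar> / c" using y2 c by (simp add: divide_right_mono)
      finally have "\<bar>q\<bar> \<le> \<alpha> * (\<bar>y\<bar> + \<bar>y\<bar> / c)" using \<alpha> unfolding q_def abs_mult by (simp add: mult_left_mono)
      then have q: "\<bar>q\<bar> \<le> Q * \<bar>y\<bar>" by (simp add: Q_def algebra_simps)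
      then have "\<bar>q\<bar>\<^sup>2 \<le> (Q * \<bar>y\<bar>)\<^sup>2" by (intro power_mono) auto
      moreover have "Q * \<bar>y\<bar> \<le> Q" using True Q mult_left_mono[of "\<bar>y\<bar>" 1 Q] by simp
      ultimately show ?thesis using q by (intro mult_mono) (auto simp: power_mult_distrib)
    qed
    also have "q \<le> \<alpha> * b * sin y + \<alpha> * y\<^sup>2 + \<alpha> / c * y\<^sup>2"
    proof -
      have "b * (y - sin y) \<le> \<bar>b\<bar> * \<bar>y - sin y\<bar>" by (metis abs_ge_self abs_mult)
      also have "\<dots> \<le> 1 * y\<^sup>2" using b abs_sin_minus_le[of y] by (intro mult_mono) (auto simp: abs_minus_commute)
      finally have "b * y \<le> b * sin y + y\<^sup>2" by (simp add: algebra_simps)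
      then have "\<alpha> * (b * y + y\<^sup>2 / c) \<le> \<alpha> * (b * sin y + y\<^sup>2 + y\<^sup>2 / c)" using \<alpha> by (intro mult_left_mono) auto
      then show ?thesis by (simp add: q_def algebra_simps)
    qed
    finally have "exp (\<alpha> * ?p) \<le> 1 + \<alpha> * b * sin y + (\<alpha> + \<alpha> / c + Q\<^sup>2 * exp Q) * y\<^sup>2"
      by (simp add: algebra_simps)
    also have "(\<alpha> + \<alpha> / c + Q\<^sup>2 * exp Q) * y\<^sup>2 \<le> K * y\<^sup>2"
      using \<alpha> by (intro mult_right_mono) (auto simp: K_def Q_def add_nonneg_nonneg)
    finally show ?thesis using y1 \<open>exp_excess \<alpha> m y = 0\<close> by simp
  next
    case False
    then have y1: "min 1 (y\<^sup>2) = 1" using abs_square_le_1[of y] by simp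
    have "huber c (d + y) \<le> huber c d + \<bar>y\<bar>" by (rule huber_lipschitz[OF c d])
    then have "?p \<le> \<bar>y\<bar>" by (auto simp: min_def)
    moreover have "min (v + huber c d) m \<ge> 0" using v huber_nonneg[OF c, of d] m by simp
    then have "?p \<le> m" by linarith
    ultimately have "?p \<le> min \<bar>y\<bar> m" by simp
    then have "\<alpha> * ?p \<le> \<alpha> * min \<bar>y\<bar> m" using \<alpha> by (intro mult_left_mono) auto
    then have "exp (\<alpha> * ?p) \<le> exp (\<alpha> * min \<bar>y\<bar> m)" by simp
    also have "\<dots> = exp \<alpha> + exp_excess \<alpha> m y" using False by (simp add: exp_excess_def max_def)
    also have "\<bar>b\<bar> * \<bar>sin y\<bar> \<le> 1 * 1" using b by (intro mult_mono) auto
    then have "\<bar>b * sin y\<bar> \<le> 1" by (simp add: abs_mult)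
    then have "\<alpha> * (- 1) \<le> \<alpha> * (b * sin y)" using \<alpha> by (intro mult_left_mono) auto
    then have "exp \<alpha> + exp_excess \<alpha> m y \<le> 1 + \<alpha> * b * sin y + (\<alpha> + exp \<alpha>) + exp_excess \<alpha> m y"
      by (simp add: algebra_simps)
    also have "\<alpha> + exp \<alpha> \<le> K" using \<alpha> c by (auto simp: K_def intro!: add_nonneg_nonneg)
    finally show ?thesis using y1 by simp
  qed note * = this
  have "exp (\<alpha> * min (v + huber c (d + y)) m) \<le>
     exp (\<alpha> * min (v + huber c d) m) * (1 + \<alpha> * b * sin y + K * min 1 (y\<^sup>2) + exp_excess \<alpha> m y)" for y
  proof -
    have "exp (\<alpha> * min (v + huber c (d + y)) m) = exp (\<alpha> * min (v + huber c d) m) * exp (\<alpha> * (min (v + huber c (d + y)) m - min (v + huber c d) m))"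
      by (simp add: algebra_simps flip: exp_add)
    also have "\<dots> \<le> exp (\<alpha> * min (v + huber c d) m) * (1 + \<alpha> * b * sin y + K * min 1 (y\<^sup>2) + exp_excess \<alpha> m y)"
      by (intro mult_left_mono *) simp
    finally show ?thesis .
  qed
  then show ?thesis using b by blast
qed

lemma huber_borel [measurable]: "huber c \<in> borel_measurable borel"
  unfolding huber_def[abs_def] by measurable

lemma exp_excess_borel [measurable]: "exp_excess \<alpha> m \<in> borel_measurable borel"
  unfolding exp_excess_def[abs_def] by measurable

lemma exp_excess_bounds:
  assumes "\<alpha> > 0" "m \<ge> 1"
  shows "0 \<le> exp_excess \<alpha> m y" "exp_excess \<alpha> m y \<le> exp (\<alpha> * m)"
    "exp_excess \<alpha> m y \<le> exp (\<alpha> * \<bar>y\<bar>) * indicator {x. \<bar>x\<bar> > 1} y"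
proof -
  have "\<alpha> * 1 \<le> \<alpha> * min (max \<bar>y\<bar> 1) m" using assms by (intro mult_left_mono) auto
  then show "0 \<le> exp_excess \<alpha> m y" by (simp add: exp_excess_def)
  have "\<alpha> * min (max \<bar>y\<bar> 1) m \<le> \<alpha> * m" using assms by (intro mult_left_mono) auto
  then have "exp (\<alpha> * min (max \<bar>y\<bar> 1) m) \<le> exp (\<alpha> * m)" by simp
  moreover have "exp \<alpha> > 0" by simp
  ultimately show "exp_excess \<alpha> m y \<le> exp (\<alpha> * m)" unfolding exp_excess_def by linarith
  show "exp_excess \<alpha> m y \<le> exp (\<alpha> * \<bar>y\<bar>) * indicator {x. \<bar>x\<bar> > 1} y"
  proof (cases "\<bar>y\<bar> > 1")
    case True
    have "\<alpha> * min (max \<bar>y\<bar> 1) m \<le> \<alpha> * \<bar>y\<bar>" using assms True by (intro mult_left_mono) auto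
    then have "exp (\<alpha> * min (max \<bar>y\<bar> 1) m) \<le> exp (\<alpha> * \<bar>y\<bar>)" by simp
    moreover have "exp \<alpha> > 0" by simp
    ultimately have "exp_excess \<alpha> m y \<le> exp (\<alpha> * \<bar>y\<bar>)" unfolding exp_excess_def by linarith
    then show ?thesis using True by simp
  next
    case False
    then show ?thesis using assms by (simp add: exp_excess_def max_def)
  qed
qed

section \<open>Iteration over independent increments\<close>

lemma play_borel:
  assumes "\<And>i. sets (N i) = sets borel" "k \<le> n"
  shows "(\<lambda>y. play_residual c y k) \<in> borel_measurable (Pi\<^sub>M {..<n} N)"
    and "(\<lambda>y. play_variation c y k) \<in> borel_measurable (Pi\<^sub>M {..<n} N)"
proof -
  have comp: "(\<lambda>y. y i) \<in> borel_measurable (Pi\<^sub>M {..<n} N)" if "i < n" for i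
    using measurable_component_singleton[of i "{..<n}" N] that assms(1)
    by (simp cong: measurable_cong_sets)
  have "(\<lambda>y. play_residual c y k) \<in> borel_measurable (Pi\<^sub>M {..<n} N) \<and> (\<lambda>y. play_variation c y k) \<in> borel_measurable (Pi\<^sub>M {..<n} N)"
    using assms(2)
  proof (induction k)
    case (Suc k)
    then have [measurable]: "(\<lambda>y. play_residual c y k) \<in> borel_measurable (Pi\<^sub>M {..<n} N)"
      "(\<lambda>y. play_variation c y k) \<in> borel_measurable (Pi\<^sub>M {..<n} N)" "(\<lambda>y. y k) \<in> borel_measurable (Pi\<^sub>M {..<n} N)"
      using comp[of k] by auto
    show ?case unfolding play_residual.simps play_variation.simps by (intro conjI) measurable
  qed simp
  then show "(\<lambda>y. play_residual c y k) \<in> borel_measurable (Pi\<^sub>M {..<n} N)"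
    "(\<lambda>y. play_variation c y k) \<in> borel_measurable (Pi\<^sub>M {..<n} N)" by auto
qed

text \<open>The hypothesis is uniform in the state, so Fubini integrates out the last increment with
  the past frozen. By \<open>huber_play_step\<close> the new potential depends on the past only
  through the variation and the residual.\<close>

lemma play_exp_moment:
  fixes c m \<alpha> r :: real
  assumes \<mu>: "real_distribution \<mu>" and c: "c > 0" and m: "m \<ge> 0" and r: "r \<ge> 0"
    and step: "\<And>d v. \<bar>d\<bar> \<le> c / 2 \<Longrightarrow> v \<ge> 0 \<Longrightarrow>
      (\<integral>\<^sup>+ y. ennreal (exp (\<alpha> * min (v + huber c (d + y)) m)) \<partial>\<mu>) \<le> ennreal (exp (\<alpha> * min (v + huber c d) m)) * ennreal r"
  shows "(\<integral>\<^sup>+ y. ennreal (exp (\<alpha> * min (play_variation c y n + huber c (play_residual c y n)) m)) \<partial>Pi\<^sub>M {..<n} (\<lambda>_. \<mu>)) \<le> ennreal (r ^ n)"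
proof -
  interpret \<mu>: real_distribution \<mu> by fact
  interpret P: product_sigma_finite "\<lambda>_::nat. \<mu>" by unfold_locales
  define W where "W y n = play_variation c y n + huber c (play_residual c y n)" for y n
  have "(\<integral>\<^sup>+ y. ennreal (exp (\<alpha> * min (W y n) m)) \<partial>Pi\<^sub>M {..<n} (\<lambda>_. \<mu>)) \<le> ennreal (r ^ n)"
  proof (induction n)
    case 0
    have "W y 0 = 0" for y using c by (simp add: W_def huber_def)
    then show ?case using m by (simp add: nn_integral_empty PiM_empty)
  next
    case (Suc n)
    let ?P = "Pi\<^sub>M {..<n} (\<lambda>_. \<mu>)"
    have meas: "(\<lambda>y. W y k) \<in> borel_measurable (Pi\<^sub>M {..<n} (\<lambda>_. \<mu>))" if "k \<le> n" for k n
      unfolding W_def using play_borel[of "\<lambda>_. \<mu>" k n c] that by simp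
    have [measurable]: "(\<lambda>y. W y n) \<in> borel_measurable ?P" by (rule meas) simp
    have [measurable]: "(\<lambda>y. W y (Suc n)) \<in> borel_measurable (Pi\<^sub>M (insert n {..<n}) (\<lambda>_. \<mu>))"
      using meas[of "Suc n" "Suc n"] by (simp add: lessThan_Suc)
    have upd: "W (y(n := z)) (Suc n) = play_variation c y n + huber c (play_residual c y n + z)" for y z
      unfolding W_def huber_play_step[OF c]
      using play_cong[of n "y(n := z)" y c] by simp
    have "(\<integral>\<^sup>+ y. ennreal (exp (\<alpha> * min (W y (Suc n)) m)) \<partial>Pi\<^sub>M {..<Suc n} (\<lambda>_. \<mu>))
        = (\<integral>\<^sup>+ y. (\<integral>\<^sup>+ z. ennreal (exp (\<alpha> * min (W (y(n := z)) (Suc n)) m)) \<partial>\<mu>) \<partial>?P)"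
      unfolding lessThan_Suc by (rule P.product_nn_integral_insert) auto
    also have "\<dots> \<le> (\<integral>\<^sup>+ y. ennreal (exp (\<alpha> * min (W y n) m)) * ennreal r \<partial>?P)"
      unfolding upd unfolding W_def
      by (intro nn_integral_mono step abs_play_residual_le c play_variation_nonneg)
    also have "\<dots> = (\<integral>\<^sup>+ y. ennreal (exp (\<alpha> * min (W y n) m)) \<partial>?P) * ennreal r"
      by (rule nn_integral_multc) measurable
    also have "\<dots> \<le> ennreal (r ^ n) * ennreal r" by (intro mult_right_mono Suc.IH) simp
    also have "\<dots> = ennreal (r ^ Suc n)" using r by (simp add: mult.commute flip: ennreal_mult)
    finally show ?case .
  qed
  then show ?thesis by (simp add: W_def)
qed

text \<open>Taking the absolute value of the mean of \<open>sin\<close> eliminates \<open>b\<close>,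
  which makes the growth factor independent of the state.\<close>

lemma huber_exp_integral_step:
  fixes \<alpha> c m :: real
  assumes \<mu>: "real_distribution \<mu>"
    and \<alpha>: "\<alpha> > 0" and c: "c > 0" and m: "m \<ge> 1" and d: "\<bar>d\<bar> \<le> c / 2" and v: "v \<ge> 0"
  defines "K \<equiv> 2 * \<alpha> + \<alpha> / c + (\<alpha> * (1 + 1 / c))\<^sup>2 * exp (\<alpha> * (1 + 1 / c)) + exp \<alpha>"
  shows "(\<integral>\<^sup>+ y. ennreal (exp (\<alpha> * min (v + huber c (d + y)) m)) \<partial>\<mu>) \<le>
    ennreal (exp (\<alpha> * min (v + huber c d) m)) *
    ennreal (1 + \<alpha> * \<bar>LINT y|\<mu>. sin y\<bar> + K * (LINT y|\<mu>. min 1 (y\<^sup>2)) + (LINT y|\<mu>. exp_excess \<alpha> m y))"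
proof -
  interpret \<mu>: real_distribution \<mu> by fact
  obtain b where b: "\<bar>b\<bar> \<le> 1" and le: "\<And>y. exp (\<alpha> * min (v + huber c (d + y)) m) \<le>
     exp (\<alpha> * min (v + huber c d) m) * (1 + \<alpha> * b * sin y + K * min 1 (y\<^sup>2) + exp_excess \<alpha> m y)"
    using huber_exp_step[OF \<alpha> c m d v] unfolding K_def by blast
  define E where "E = exp (\<alpha> * min (v + huber c d) m)"
  have i1: "integrable \<mu> (\<lambda>y. sin y)" by (rule \<mu>.integrable_const_bound[where B=1]) auto
  have i2: "integrable \<mu> (\<lambda>y. min 1 (y\<^sup>2))" by (rule \<mu>.integrable_const_bound[where B=1]) auto
  have i3: "integrable \<mu> (\<lambda>y. exp_excess \<alpha> m y)"
    using exp_excess_bounds[OF \<alpha> m] by (intro \<mu>.integrable_const_bound[where B="exp (\<alpha> * m)"]) auto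
  have i: "integrable \<mu> (\<lambda>y. 1 + \<alpha> * b * sin y + K * min 1 (y\<^sup>2) + exp_excess \<alpha> m y)"
    using i1 i2 i3 by (intro Bochner_Integration.integrable_add integrable_mult_right) auto
  \<comment> \<open>The right-hand side dominates an exponential; its sign lets the nonnegative
    integral be computed as a Lebesgue integral.\<close>
  have nn: "0 \<le> E * (1 + \<alpha> * b * sin y + K * min 1 (y\<^sup>2) + exp_excess \<alpha> m y)" for y
    using le[of y] unfolding E_def by (rule order_trans[OF less_imp_le[OF exp_gt_zero]])
  have "(\<integral>\<^sup>+ y. ennreal (exp (\<alpha> * min (v + huber c (d + y)) m)) \<partial>\<mu>)
      \<le> (\<integral>\<^sup>+ y. ennreal (E * (1 + \<alpha> * b * sin y + K * min 1 (y\<^sup>2) + exp_excess \<alpha> m y)) \<partial>\<mu>)"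
    using le unfolding E_def by (intro nn_integral_mono ennreal_leI)
  also have "\<dots> = ennreal (LINT y|\<mu>. E * (1 + \<alpha> * b * sin y + K * min 1 (y\<^sup>2) + exp_excess \<alpha> m y))"
    using i nn by (intro nn_integral_eq_integral integrable_mult_right) auto
  also have "(LINT y|\<mu>. E * (1 + \<alpha> * b * sin y + K * min 1 (y\<^sup>2) + exp_excess \<alpha> m y))
      = E * (1 + \<alpha> * b * (LINT y|\<mu>. sin y) + K * (LINT y|\<mu>. min 1 (y\<^sup>2)) + (LINT y|\<mu>. exp_excess \<alpha> m y))"
    using i1 i2 i3 \<mu>.prob_space by simp
  also have "\<dots> \<le> E * (1 + \<alpha> * \<bar>LINT y|\<mu>. sin y\<bar> + K * (LINT y|\<mu>. min 1 (y\<^sup>2)) + (LINT y|\<mu>. exp_excess \<alpha> m y))"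
  proof -
    have "b * (LINT y|\<mu>. sin y) \<le> \<bar>b\<bar> * \<bar>LINT y|\<mu>. sin y\<bar>" by (metis abs_ge_self abs_mult)
    also have "\<dots> \<le> \<bar>LINT y|\<mu>. sin y\<bar>" using mult_right_mono[OF b, of "\<bar>LINT y|\<mu>. sin y\<bar>"] by simp
    finally have "\<alpha> * (b * (LINT y|\<mu>. sin y)) \<le> \<alpha> * \<bar>LINT y|\<mu>. sin y\<bar>" using \<alpha> by (intro mult_left_mono) auto
    then show ?thesis by (intro mult_left_mono) (auto simp: E_def)
  qed
  finally show ?thesis by (simp add: E_def ennreal_leI flip: ennreal_mult')
qed

section \<open>Exponentials of the truncated variation\<close>

lemma exp_ennreal_ge:
  assumes "ennreal a \<le> x" "\<alpha> \<ge> 0" "a \<ge> 0"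
  shows "ennreal (exp (\<alpha> * a)) \<le> exp_ennreal \<alpha> x"
proof (cases "x = \<infinity>")
  case False
  then have "a \<le> enn2real x"
    using enn2real_mono[OF assms(1)] assms(3) by (simp add: less_top)
  then show ?thesis using False assms(2) by (auto simp: exp_ennreal_def intro!: ennreal_leI mult_left_mono)
qed (simp add: exp_ennreal_def)

text \<open>For finite \<open>L\<close>, taking logarithms bounds the supremum itself, which
  excludes the infinite branch of \<open>exp_ennreal\<close>.\<close>

lemma exp_ennreal_SUP_le:
  assumes "\<alpha> > 0" "\<And>i. i \<in> I \<Longrightarrow> ennreal (exp (\<alpha> * a i)) \<le> L" "I \<noteq> {}" "\<And>i. i \<in> I \<Longrightarrow> a i \<ge> 0"
  shows "exp_ennreal \<alpha> (SUP i\<in>I. ennreal (a i)) \<le> L"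
proof (cases L)
  case (real l)
  have le: "exp (\<alpha> * a i) \<le> l" if "i \<in> I" for i
    using assms(2)[OF that] real by simp
  obtain i0 where i0: "i0 \<in> I" using assms(3) by blast
  \<comment> \<open>Some index exists and its value is nonnegative, so l is at least 1 and ln l /
    \<alpha> survives the passage through \<open>ennreal\<close>.\<close>
  have "1 \<le> exp (\<alpha> * a i0)" using assms(1) assms(4)[OF i0] by simp
  with le[OF i0] have l: "1 \<le> l" by linarith
  have "a i \<le> ln l / \<alpha>" if "i \<in> I" for i
  proof -
    have "\<alpha> * a i \<le> ln l" using le[OF that] l by (simp add: ln_ge_iff)
    then show ?thesis using assms(1) by (simp add: field_simps)
  qed
  then have *: "(SUP i\<in>I. ennreal (a i)) \<le> ennreal (ln l / \<alpha>)"
    by (intro SUP_least ennreal_leI)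
  then have fin: "(SUP i\<in>I. ennreal (a i)) \<noteq> \<infinity>" by (metis ennreal_neq_top infinity_ennreal_def top_unique)
  have "enn2real (SUP i\<in>I. ennreal (a i)) \<le> ln l / \<alpha>"
    using enn2real_mono[OF *] assms(1) l by simp
  then have "\<alpha> * enn2real (SUP i\<in>I. ennreal (a i)) \<le> ln l" using assms(1) by (simp add: field_simps)
  then have "exp (\<alpha> * enn2real (SUP i\<in>I. ennreal (a i))) \<le> l" using l by (simp add: ln_ge_iff)
  moreover have "exp_ennreal \<alpha> (SUP i\<in>I. ennreal (a i)) = ennreal (exp (\<alpha> * enn2real (SUP i\<in>I. ennreal (a i))))"
    by (simp only: exp_ennreal_def fin if_False)
  ultimately show ?thesis using real by (simp only: ennreal_leI)
qed simp

text \<open>Points are approximated by grid points from the right, where the path is continuous.\<close>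

lemma exp_TVc_le_liminf_play:
  fixes f :: "real \<Rightarrow> real" and N :: "nat \<Rightarrow> nat"
  assumes f: "cadlag f" and S: "S > 0" and c: "c > 0" and \<alpha>: "\<alpha> > 0" and N: "\<And>m. N m \<ge> Suc m"
  defines "y \<equiv> \<lambda>m i. f (real (Suc i) * (S / N m)) - f (real i * (S / N m))"
  shows "exp_ennreal \<alpha> (TVc c f S) \<le> liminf (\<lambda>m. ennreal (exp (\<alpha> * min (play_variation c (y m) (N m)) (real m))))"
  (is "_ \<le> liminf ?L")
proof -
  \<comment> \<open>The partition is fixed while m grows; the supremum over partitions is taken only
    at the end.\<close>
  have main: "ennreal (exp (\<alpha> * (\<Sum>i\<in>{1..n}. max (\<bar>f (t i) - f (t (i - 1))\<bar> - c) 0))) \<le> liminf ?L"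
    if t: "0 \<le> t 0" "\<forall>i<n. t i < t (Suc i)" "t n \<le> S" for n and t :: "nat \<Rightarrow> real"
  proof -
    have mono: "t i \<le> t j" if "i \<le> j" "j \<le> n" for i j
      using that
    proof (induction j rule: dec_induct)
      case (step j)
      then show ?case using t(2)[rule_format, of j] by simp
    qed simp
    have t0: "t i \<ge> 0" if "i \<le> n" for i using mono[of 0 i] t(1) that by simp
    have N0: "real (N m) > 0" for m using N[of m] by simp
    \<comment> \<open>Rounding up preserves the order of the points, approaches them from the right,
      and does not pass the last index \<open>N m\<close>, since \<open>t n\<close> is at most
      S.\<close>
    define idx where "idx m i = nat \<lceil>t i * (N m / S)\<rceil>" for m i
    define g where "g m i = real (idx m i) * (S / N m)" for m i
    have idx_bounds: "t i * (N m / S) \<le> real (idx m i)" "real (idx m i) \<le> t i * (N m / S) + 1" if "i \<le> n" for m i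
    proof -
      have "0 \<le> t i * (N m / S)" using t0[OF that] S by simp
      then have "0 \<le> \<lceil>t i * (N m / S)\<rceil>" by (simp add: order_less_le_trans[of "-1" 0])
      then have "real (idx m i) = real_of_int \<lceil>t i * (N m / S)\<rceil>" by (simp add: idx_def)
      then show "t i * (N m / S) \<le> real (idx m i)" "real (idx m i) \<le> t i * (N m / S) + 1" by linarith+
    qed
    have g_ge: "t i \<le> g m i" if "i \<le> n" for m i
      using mult_right_mono[OF idx_bounds(1)[OF that, of m], of "S / N m"] S N0[of m] by (simp add: g_def)
    have g_le: "g m i \<le> t i + S / Suc m" if "i \<le> n" for m i
    proof -
      have "g m i \<le> (t i * (N m / S) + 1) * (S / N m)"
        unfolding g_def using S by (intro mult_right_mono idx_bounds(2) that) simp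
      also have "\<dots> = t i + S / N m" using S N0[of m] by (simp add: field_simps)
      also have "S / N m \<le> S / Suc m" using S N[of m] by (intro divide_left_mono) auto
      finally show ?thesis by simp
    qed
    have g_lim: "(\<lambda>m. g m i) \<longlonglongrightarrow> t i" if "i \<le> n" for i
    proof (rule tendsto_sandwich[of "\<lambda>_. t i" _ _ "\<lambda>m. t i + S / Suc m"])
      have "(\<lambda>m. t i + S * inverse (real (Suc m))) \<longlonglongrightarrow> t i + S * 0"
        by (intro tendsto_intros LIMSEQ_inverse_real_of_nat)
      then show "(\<lambda>m. t i + S / Suc m) \<longlonglongrightarrow> t i" by (simp add: divide_inverse)
    qed (use g_ge g_le that in auto)
    have f_lim: "(\<lambda>m. f (g m i)) \<longlonglongrightarrow> f (t i)" if "i \<le> n" for i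
    proof -
      have "continuous (at (t i) within {t i..}) f"
        using f t0[OF that] by (simp add: cadlag_def at_within_Ici_at_right)
      then show ?thesis
        using g_lim[OF that] g_ge[OF that] unfolding continuous_within_sequentially by (auto simp: o_def)
    qed
    define a where "a m = (\<Sum>i\<in>{1..n}. max (\<bar>f (g m i) - f (g m (i - 1))\<bar> - c) 0)" for m
    define b where "b = (\<Sum>i\<in>{1..n}. max (\<bar>f (t i) - f (t (i - 1))\<bar> - c) 0)"
    have a_lim: "a \<longlonglongrightarrow> b"
      unfolding a_def b_def by (intro tendsto_intros f_lim) auto
    have a_le: "a m \<le> play_variation c (y m) (N m)" for m
    proof -
      have *: "f (real k * (S / N m)) = f 0 + (\<Sum>j<k. y m j)" for k
        unfolding y_def by (subst sum_lessThan_telescope) simp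
      have "a m = (\<Sum>i\<in>{1..n}. max (\<bar>(\<Sum>j<idx m i. y m j) - (\<Sum>j<idx m (i - 1). y m j)\<bar> - c) 0)"
        unfolding a_def g_def by (simp only: * add_diff_cancel_left)
      also have "\<dots> \<le> play_variation c (y m) (N m)"
      proof (rule truncated_variation_le_play_variation[OF c])
        fix i assume "i < n"
        then have "t i * (N m / S) \<le> t (Suc i) * (N m / S)"
          using t(2) S by (intro mult_right_mono) (auto intro: less_imp_le)
        then show "idx m i \<le> idx m (Suc i)" unfolding idx_def by (intro nat_mono ceiling_mono)
      next
        have "t n * (N m / S) \<le> S * (N m / S)" using t(3) S by (intro mult_right_mono) auto
        then have "t n * (N m / S) \<le> N m" using S by simp
        then show "idx m n \<le> N m" unfolding idx_def by (simp add: ceiling_le_iff)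
      qed
      finally show ?thesis .
    qed
    \<comment> \<open>The sums converge while the cap m grows, so the cap is eventually
      inactive.\<close>
    have "eventually (\<lambda>m. a m < b + 1) sequentially"
      using order_tendstoD(2)[OF a_lim, of "b + 1"] by simp
    moreover have "eventually (\<lambda>m. b + 1 \<le> real m) sequentially"
      using filterlim_real_sequentially by (simp add: filterlim_at_top)
    ultimately have "eventually (\<lambda>m. min (a m) (real m) = a m) sequentially"
      by eventually_elim simp
    then have "(\<lambda>m. min (a m) (real m)) \<longlonglongrightarrow> b"
      using a_lim by (rule tendsto_cong[THEN iffD2])
    then have "(\<lambda>m. ennreal (exp (\<alpha> * min (a m) (real m)))) \<longlonglongrightarrow> ennreal (exp (\<alpha> * b))"
      by (intro tendsto_intros)
    then have "ennreal (exp (\<alpha> * b)) = liminf (\<lambda>m. ennreal (exp (\<alpha> * min (a m) (real m))))"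
      by (intro lim_imp_Liminf[symmetric]) auto
    also have "\<dots> \<le> liminf ?L"
    proof (intro Liminf_mono always_eventually allI ennreal_leI)
      fix m
      have "\<alpha> * min (a m) (real m) \<le> \<alpha> * min (play_variation c (y m) (N m)) (real m)"
        using \<alpha> a_le[of m] by (intro mult_left_mono) auto
      then show "exp (\<alpha> * min (a m) (real m)) \<le> exp (\<alpha> * min (play_variation c (y m) (N m)) (real m))" by simp
    qed
    finally show ?thesis unfolding b_def .
  qed
  let ?I = "{(n::nat, t::nat \<Rightarrow> real). 0 \<le> t 0 \<and> (\<forall>i<n. t i < t (Suc i)) \<and> t n \<le> S}"
  let ?a = "\<lambda>p. case p of (n, t) \<Rightarrow> \<Sum>i\<in>{1..n}. max (\<bar>f (t i) - f (t (i - 1))\<bar> - c) 0"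
  have "exp_ennreal \<alpha> (SUP p\<in>?I. ennreal (?a p)) \<le> liminf ?L"
  proof (rule exp_ennreal_SUP_le[OF \<alpha>])
    show "ennreal (exp (\<alpha> * ?a p)) \<le> liminf ?L" if "p \<in> ?I" for p
      using main that by (cases p) auto
    have "(0, \<lambda>_. 0) \<in> ?I" using S by simp
    then show "?I \<noteq> {}" by (rule ex_in_conv[THEN iffD1, OF exI])
    show "?a p \<ge> 0" for p by (cases p) (auto intro: sum_nonneg)
  qed
  moreover have "TVc c f S = (SUP p\<in>?I. ennreal (?a p))"
    unfolding TVc_def by (intro SUP_cong) auto
  ultimately show ?thesis by simp
qed

lemma TVc_ge_grid:
  assumes S: "S > 0"
  shows "ennreal (\<Sum>i<Suc n. max (\<bar>f (real (Suc i) * (S / Suc n)) - f (real i * (S / Suc n))\<bar> - c) 0) \<le> TVc c f S"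
proof -
  define t where "t i = real i * (S / Suc n)" for i
  have "(Suc n, t) \<in> {(n::nat, t::nat \<Rightarrow> real). 0 \<le> t 0 \<and> (\<forall>i<n. t i < t (Suc i)) \<and> t n \<le> S}"
  proof (safe, goal_cases)
    case (2 i)
    show ?case unfolding t_def using S by (intro mult_strict_right_mono) auto
  qed (use S in \<open>auto simp: t_def\<close>)
  then have "ennreal (\<Sum>i\<in>{1..Suc n}. max (\<bar>f (t i) - f (t (i - 1))\<bar> - c) 0) \<le> TVc c f S"
    unfolding TVc_def by (rule SUP_upper2) (simp only: prod.case order_refl)
  also have "(\<Sum>i\<in>{1..Suc n}. max (\<bar>f (t i) - f (t (i - 1))\<bar> - c) 0) = (\<Sum>i<Suc n. max (\<bar>f (t (Suc i)) - f (t i)\<bar> - c) 0)"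
    by (simp only: One_nat_def sum.atLeast1_atMost_eq diff_Suc_Suc diff_zero)
  finally show ?thesis by (simp only: t_def)
qed

section \<open>Exponential moments\<close>

lemma levy_process_grid:
  assumes L: "levy_process M X A \<nu> \<gamma>" and h: "h \<ge> 0"
  shows "\<And>i. (\<lambda>\<omega>. X (real (Suc i) * h) \<omega> - X (real i * h) \<omega>) \<in> borel_measurable M"
    and "\<And>i. distr M borel (\<lambda>\<omega>. X (real (Suc i) * h) \<omega> - X (real i * h) \<omega>) = distr M borel (X h)"
    and "\<And>k. prob_space.indep_vars M (\<lambda>_. borel) (\<lambda>i \<omega>. X (real (Suc i) * h) \<omega> - X (real i * h) \<omega>) {..<k::nat}"
    and "real_distribution (distr M borel (X h))"
proof -
  interpret prob_space M using L by (simp add: levy_process_def)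
  have X: "X t \<in> borel_measurable M" if "t \<ge> 0" for t
    using L that by (simp add: levy_process_def)
  show "(\<lambda>\<omega>. X (real (Suc i) * h) \<omega> - X (real i * h) \<omega>) \<in> borel_measurable M" for i
    using X[of "real (Suc i) * h"] X[of "real i * h"] h by simp
  have "distr M borel (\<lambda>\<omega>. X (s + h) \<omega> - X s \<omega>) = distr M borel (X h)" if "s \<ge> 0" for s
    using L h that by (simp add: levy_process_def)
  from this[of "real i * h" for i] h
  show "distr M borel (\<lambda>\<omega>. X (real (Suc i) * h) \<omega> - X (real i * h) \<omega>) = distr M borel (X h)" for i
    by (simp add: algebra_simps)
  have "indep_vars (\<lambda>_. borel) (\<lambda>i \<omega>. X (t (Suc i)) \<omega> - X (t i) \<omega>) {..<k}"
    if "0 \<le> t 0" "\<forall>i<k. t i \<le> t (Suc i)" for k and t :: "nat \<Rightarrow> real"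
    using L that by (simp add: levy_process_def)
  from this[of "\<lambda>i. real i * h"] h
  show "indep_vars (\<lambda>_. borel) (\<lambda>i \<omega>. X (real (Suc i) * h) \<omega> - X (real i * h) \<omega>) {..<k}" for k
    by (simp add: mult_right_mono)
  show "real_distribution (distr M borel (X h))"
    using X[OF h] by (intro real_distribution_distr)
qed

lemma levy_process_char:
  assumes L: "levy_process M X A \<nu> \<gamma>" and S: "S > 0"
  shows "char (distr M borel (X (S / Suc n))) u = exp (complex_of_real (S / Suc n) * levy_exponent A \<nu> \<gamma> u)"
  using L S by (simp add: levy_process_def del: of_nat_Suc)

text \<open>By independence and stationarity the increments have a product law, which transfers
  \<open>play_exp_moment\<close> to the process. The restriction in \<open>?Y\<close> is harmless
  because the play reads only the first \<open>Suc n\<close> increments.\<close>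

lemma levy_process_play_moment:
  fixes c m \<alpha> r :: real
  assumes L: "levy_process M X A \<nu> \<gamma>" and h: "h \<ge> 0" and \<alpha>: "\<alpha> > 0" and c: "c > 0" and m: "m \<ge> 0" and r: "r \<ge> 0"
    and step: "\<And>d v. \<bar>d\<bar> \<le> c / 2 \<Longrightarrow> v \<ge> 0 \<Longrightarrow>
      (\<integral>\<^sup>+ y. ennreal (exp (\<alpha> * min (v + huber c (d + y)) m)) \<partial>distr M borel (X h)) \<le> ennreal (exp (\<alpha> * min (v + huber c d) m)) * ennreal r"
  defines "y \<equiv> \<lambda>\<omega> i. X (real (Suc i) * h) \<omega> - X (real i * h) \<omega>"
  shows "(\<lambda>\<omega>. play_variation c (y \<omega>) (Suc n)) \<in> borel_measurable M"
    and "(\<integral>\<^sup>+ \<omega>. ennreal (exp (\<alpha> * min (play_variation c (y \<omega>) (Suc n)) m)) \<partial>M) \<le> ennreal (r ^ Suc n)"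
proof -
  interpret prob_space M using L by (simp add: levy_process_def)
  note G = levy_process_grid[OF L h]
  let ?\<mu> = "distr M borel (X h)"
  let ?I = "{..<Suc n}"
  let ?Y = "\<lambda>\<omega>. \<lambda>i\<in>?I. y \<omega> i"
  have "distr M (Pi\<^sub>M ?I (\<lambda>_. borel)) ?Y = Pi\<^sub>M ?I (\<lambda>i. distr M borel (\<lambda>\<omega>. y \<omega> i))"
    unfolding y_def
    by (rule indep_vars_iff_distr_eq_PiM'[THEN iffD1, OF _ _ G(3)[of "Suc n"]]) (auto intro: G(1) simp del: of_nat_Suc)
  also have "\<dots> = Pi\<^sub>M ?I (\<lambda>_. ?\<mu>)"
    by (simp only: y_def G(2))
  finally have D: "distr M (Pi\<^sub>M ?I (\<lambda>_. borel)) ?Y = Pi\<^sub>M ?I (\<lambda>_. ?\<mu>)" .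
  have Y: "?Y \<in> measurable M (Pi\<^sub>M ?I (\<lambda>_. borel))"
    using G(1) by (intro measurable_restrict) (simp add: y_def)
  have eq: "play_variation c (?Y \<omega>) (Suc n) = play_variation c (y \<omega>) (Suc n)" for \<omega>
    by (rule play_cong) simp
  have pm: "(\<lambda>y. play_variation c y (Suc n)) \<in> borel_measurable (Pi\<^sub>M ?I (\<lambda>_. borel))"
    "(\<lambda>y. play_residual c y (Suc n)) \<in> borel_measurable (Pi\<^sub>M ?I (\<lambda>_. borel))"
    by (rule play_borel; simp)+
  show "(\<lambda>\<omega>. play_variation c (y \<omega>) (Suc n)) \<in> borel_measurable M"
    using measurable_compose[OF Y pm(1)] unfolding eq .
  have mf: "(\<lambda>y. ennreal (exp (\<alpha> * min (play_variation c y (Suc n)) m))) \<in> borel_measurable (distr M (Pi\<^sub>M ?I (\<lambda>_. borel)) ?Y)"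
    unfolding measurable_distr_eq1 by (rule measurable_compose[OF pm(1)]) measurable
  have "(\<integral>\<^sup>+ \<omega>. ennreal (exp (\<alpha> * min (play_variation c (y \<omega>) (Suc n)) m)) \<partial>M)
      = (\<integral>\<^sup>+ y. ennreal (exp (\<alpha> * min (play_variation c y (Suc n)) m)) \<partial>Pi\<^sub>M ?I (\<lambda>_. ?\<mu>))"
    unfolding D[symmetric] nn_integral_distr[OF Y mf] eq ..
  \<comment> \<open>The Huber term is nonnegative; it is added here to make the recursion
    close.\<close>
  also have "\<dots> \<le> (\<integral>\<^sup>+ y. ennreal (exp (\<alpha> * min (play_variation c y (Suc n) + huber c (play_residual c y (Suc n))) m)) \<partial>Pi\<^sub>M ?I (\<lambda>_. ?\<mu>))"
  proof (intro nn_integral_mono ennreal_leI)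
    fix y
    have "min (play_variation c y (Suc n)) m \<le> min (play_variation c y (Suc n) + huber c (play_residual c y (Suc n))) m"
      using huber_nonneg[OF c] by (intro min.mono) (simp_all del: play_variation.simps play_residual.simps)
    then show "exp (\<alpha> * min (play_variation c y (Suc n)) m) \<le> exp (\<alpha> * min (play_variation c y (Suc n) + huber c (play_residual c y (Suc n))) m)"
      using \<alpha> by (simp del: play_variation.simps play_residual.simps)
  qed
  also have "\<dots> \<le> ennreal (r ^ Suc n)"
    by (rule play_exp_moment[OF G(4) c m r step])
  finally show "(\<integral>\<^sup>+ \<omega>. ennreal (exp (\<alpha> * min (play_variation c (y \<omega>) (Suc n)) m)) \<partial>M) \<le> ennreal (r ^ Suc n)" .
qed

lemma exp_TVc_integrable_if:
  assumes L: "levy_process M X A \<nu> \<gamma>" and S: "S > 0" and c: "c > 0" and \<alpha>: "\<alpha> > 0"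
    and fin: "(\<integral>\<^sup>+ x \<in> {x. \<bar>x\<bar> > 1}. ennreal (exp (\<alpha> * \<bar>x\<bar>)) \<partial>\<nu>) < \<infinity>"
  shows "(\<integral>\<^sup>+ \<omega>. exp_ennreal \<alpha> (TVc c (\<lambda>t. X t \<omega>) S) \<partial>M) < \<infinity>"
proof -
  interpret prob_space M using L by (simp add: levy_process_def)
  have \<nu>: "levy_measure \<nu>" using L by (simp add: levy_process_def)
  have [measurable_cong]: "sets \<nu> = sets borel" using \<nu> by (simp add: levy_measure_def)
  define \<mu> where "\<mu> n = distr M borel (X (S / Suc n))" for n
  have \<mu>: "real_distribution (\<mu> n)" for n
    unfolding \<mu>_def using S by (intro levy_process_grid(4)[OF L]) simp
  have ch: "char (\<mu> n) u = exp (complex_of_real (S / Suc n) * levy_exponent A \<nu> \<gamma> u)" for n u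
    unfolding \<mu>_def by (rule levy_process_char[OF L S])
  \<comment> \<open>This bounds the integrals of all the capped excesses at once, which keeps
    \<open>R\<close> below free of m.\<close>
  define J where "J = enn2real (\<integral>\<^sup>+ x \<in> {x. \<bar>x\<bar> > 1}. ennreal (exp (\<alpha> * \<bar>x\<bar>)) \<partial>\<nu>)"
  have J: "(LINT x|\<nu>. exp_excess \<alpha> m x) \<le> J" if "m \<ge> 1" for m
  proof -
    note e = exp_excess_bounds[OF \<alpha> that]
    have le: "(\<integral>\<^sup>+ x. ennreal (exp_excess \<alpha> m x) \<partial>\<nu>) \<le> (\<integral>\<^sup>+ x \<in> {x. \<bar>x\<bar> > 1}. ennreal (exp (\<alpha> * \<bar>x\<bar>)) \<partial>\<nu>)"
    proof (rule nn_integral_mono)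
      fix x
      show "ennreal (exp_excess \<alpha> m x) \<le> ennreal (exp (\<alpha> * \<bar>x\<bar>)) * indicator {x. \<bar>x\<bar> > 1} x"
        using ennreal_leI[OF e(3)[of x]] by (cases "\<bar>x\<bar> > 1") auto
    qed
    have "(LINT x|\<nu>. exp_excess \<alpha> m x) = enn2real (\<integral>\<^sup>+ x. ennreal (exp_excess \<alpha> m x) \<partial>\<nu>)"
      using e(1) by (intro integral_eq_nn_integral) auto
    also have "\<dots> \<le> J" unfolding J_def using le fin by (intro enn2real_mono) auto
    finally show ?thesis .
  qed
  obtain C where C: "\<And>n. real (Suc n) * \<bar>LINT x|\<mu> n. sin x\<bar> \<le> C" "\<And>n. real (Suc n) * (LINT x|\<mu> n. min 1 (x\<^sup>2)) \<le> C"
    using levy_small_time_bounds[OF \<nu> \<mu> ch S] by blast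
  define K where "K = 2 * \<alpha> + \<alpha> / c + (\<alpha> * (1 + 1 / c))\<^sup>2 * exp (\<alpha> * (1 + 1 / c)) + exp \<alpha>"
  have K: "K \<ge> 0" using \<alpha> c by (auto simp: K_def intro!: add_nonneg_nonneg mult_nonneg_nonneg)
  define R where "R = \<alpha> * C + K * C + (S * J + 1)"
  \<comment> \<open>The limit is available for each fixed m only, hence the choice of n after m; the
    summand 1 leaves room for the limit to be undershot.\<close>
  have ex: "\<exists>n\<ge>m. real (Suc n) * (LINT x|\<mu> n. exp_excess \<alpha> (real m) x) \<le> S * J + 1" if "m \<ge> 1" for m :: nat
  proof -
    have m: "real m \<ge> 1" using that by simp
    note e = exp_excess_bounds[OF \<alpha> m]
    have "(\<lambda>n. real (Suc n) * (LINT x|\<mu> n. exp_excess \<alpha> m x)) \<longlonglongrightarrow> S * (LINT x|\<nu>. exp_excess \<alpha> m x)"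
    proof (rule levy_small_time_limit[OF \<nu> \<mu> ch S])
      show "isCont (exp_excess \<alpha> m) x" for x
        unfolding exp_excess_def[abs_def] by (intro continuous_intros)
      show "\<bar>exp_excess \<alpha> m x\<bar> \<le> exp (\<alpha> * m)" for x using e(1,2)[of x] by simp
      show "exp_excess \<alpha> m x = 0" if "\<bar>x\<bar> < 1" for x using that m by (simp add: exp_excess_def)
    qed simp
    moreover have "S * (LINT x|\<nu>. exp_excess \<alpha> m x) < S * J + 1"
      using mult_left_mono[OF J[OF m], of S] S by linarith
    ultimately have "eventually (\<lambda>n. real (Suc n) * (LINT x|\<mu> n. exp_excess \<alpha> m x) < S * J + 1) sequentially"
      by (rule order_tendstoD(2))
    then obtain n0 where "\<And>n. n \<ge> n0 \<Longrightarrow> real (Suc n) * (LINT x|\<mu> n. exp_excess \<alpha> m x) < S * J + 1"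
      by (auto simp: eventually_sequentially)
    then show ?thesis by (intro exI[of _ "max n0 m"]) (auto intro: less_imp_le simp del: of_nat_Suc)
  qed
  \<comment> \<open>The cap \<open>Suc m\<close> is at least 1 even for m = 0.\<close>
  have "\<forall>m. \<exists>n\<ge>Suc m. real (Suc n) * (LINT x|\<mu> n. exp_excess \<alpha> (real (Suc m)) x) \<le> S * J + 1"
    by (intro allI ex) simp
  then obtain N where N: "\<And>m. N m \<ge> Suc m" "\<And>m. real (Suc (N m)) * (LINT x|\<mu> (N m). exp_excess \<alpha> (real (Suc m)) x) \<le> S * J + 1"
    by metis
  define V where "V m \<omega> = play_variation c (\<lambda>i. X (real (Suc i) * (S / Suc (N m))) \<omega> - X (real i * (S / Suc (N m))) \<omega>) (Suc (N m))" for m \<omega>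
  have V: "V m \<in> borel_measurable M"
    "(\<integral>\<^sup>+ \<omega>. ennreal (exp (\<alpha> * min (V m \<omega>) (real (Suc m)))) \<partial>M) \<le> ennreal (exp R)" for m
  proof -
    define n where "n = N m"
    interpret \<mu>: real_distribution "\<mu> n" by (rule \<mu>)
    define r where "r = 1 + \<alpha> * \<bar>LINT y|\<mu> n. sin y\<bar> + K * (LINT y|\<mu> n. min 1 (y\<^sup>2)) + (LINT y|\<mu> n. exp_excess \<alpha> (real (Suc m)) y)"
    have m: "real (Suc m) \<ge> 1" by simp
    note e = exp_excess_bounds[OF \<alpha> m]
    have "(LINT y|\<mu> n. exp_excess \<alpha> (real (Suc m)) y) \<ge> 0" by (intro integral_nonneg_AE) (simp add: e del: of_nat_Suc)
    moreover have "(LINT y|\<mu> n. min 1 (y\<^sup>2)) \<ge> 0" by (intro integral_nonneg_AE) simp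
    ultimately have r: "r \<ge> 0" unfolding r_def using \<alpha> K by (intro add_nonneg_nonneg mult_nonneg_nonneg) auto
    have "real (Suc n) * (r - 1) = \<alpha> * (real (Suc n) * \<bar>LINT y|\<mu> n. sin y\<bar>) + K * (real (Suc n) * (LINT y|\<mu> n. min 1 (y\<^sup>2)))
        + real (Suc n) * (LINT y|\<mu> n. exp_excess \<alpha> (real (Suc m)) y)"
      unfolding r_def by (simp add: algebra_simps)
    also have "\<dots> \<le> R"
      unfolding R_def using C[of n] \<alpha> K N(2)[of m] unfolding n_def
      by (intro add_mono mult_left_mono) (auto simp del: of_nat_Suc)
    finally have "real (Suc n) * (r - 1) \<le> R" .
    \<comment> \<open>Hence (1 + R / n)^n is at most exp R.\<close>
    have "r \<le> exp (r - 1)" using exp_ge_add_one_self[of "r - 1"] by simp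
    then have "r ^ Suc n \<le> exp (r - 1) ^ Suc n" using r by (intro power_mono)
    also have "\<dots> = exp (real (Suc n) * (r - 1))" by (rule exp_of_nat_mult[symmetric])
    also have "\<dots> \<le> exp R" using \<open>real (Suc n) * (r - 1) \<le> R\<close> by simp
    finally have rR: "r ^ Suc n \<le> exp R" .
    have step: "(\<integral>\<^sup>+ y. ennreal (exp (\<alpha> * min (v + huber c (d + y)) (real (Suc m)))) \<partial>distr M borel (X (S / Suc n)))
        \<le> ennreal (exp (\<alpha> * min (v + huber c d) (real (Suc m)))) * ennreal r" if "\<bar>d\<bar> \<le> c / 2" "v \<ge> 0" for d v
      using huber_exp_integral_step[OF \<mu> \<alpha> c m that, of n] unfolding r_def K_def \<mu>_def .
    have h: "S / Suc n \<ge> 0" using S by simp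
    have "V m = (\<lambda>\<omega>. play_variation c (\<lambda>i. X (real (Suc i) * (S / Suc n)) \<omega> - X (real i * (S / Suc n)) \<omega>) (Suc n))"
      unfolding V_def n_def ..
    note V_eq = this
    show "V m \<in> borel_measurable M"
      unfolding V_eq by (rule levy_process_play_moment(1)[OF L h \<alpha> c _ r step]) auto
    have "(\<integral>\<^sup>+ \<omega>. ennreal (exp (\<alpha> * min (V m \<omega>) (real (Suc m)))) \<partial>M) \<le> ennreal (r ^ Suc n)"
      unfolding V_eq by (rule levy_process_play_moment(2)[OF L h \<alpha> c _ r step]) auto
    also have "\<dots> \<le> ennreal (exp R)" by (intro ennreal_leI rR)
    finally show "(\<integral>\<^sup>+ \<omega>. ennreal (exp (\<alpha> * min (V m \<omega>) (real (Suc m)))) \<partial>M) \<le> ennreal (exp R)" .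
  qed
  note V(1)[measurable]
  have "exp_ennreal \<alpha> (TVc c (\<lambda>t. X t \<omega>) S) \<le> liminf (\<lambda>m. ennreal (exp (\<alpha> * min (V m \<omega>) (real m))))" if "\<omega> \<in> space M" for \<omega>
    unfolding V_def using L that N(1)
    by (intro exp_TVc_le_liminf_play[where N="\<lambda>m. Suc (N m)"] S c \<alpha>) (auto simp: levy_process_def le_Suc_eq)
  then have "(\<integral>\<^sup>+ \<omega>. exp_ennreal \<alpha> (TVc c (\<lambda>t. X t \<omega>) S) \<partial>M) \<le> (\<integral>\<^sup>+ \<omega>. liminf (\<lambda>m. ennreal (exp (\<alpha> * min (V m \<omega>) (real m)))) \<partial>M)"
    by (rule nn_integral_mono)
  also have "\<dots> \<le> liminf (\<lambda>m. \<integral>\<^sup>+ \<omega>. ennreal (exp (\<alpha> * min (V m \<omega>) (real m))) \<partial>M)"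
    by (rule nn_integral_liminf) measurable
  also have "\<dots> \<le> liminf (\<lambda>m. ennreal (exp R))"
  \<comment> \<open>The path estimate uses the cap m while \<open>V\<close> was bounded with the
    larger cap \<open>Suc m\<close>.\<close>
  proof (intro Liminf_mono always_eventually allI)
    fix m
    have "(\<integral>\<^sup>+ \<omega>. ennreal (exp (\<alpha> * min (V m \<omega>) (real m))) \<partial>M) \<le> (\<integral>\<^sup>+ \<omega>. ennreal (exp (\<alpha> * min (V m \<omega>) (real (Suc m)))) \<partial>M)"
      using \<alpha> by (intro nn_integral_mono ennreal_leI) (auto intro!: mult_left_mono)
    also have "\<dots> \<le> ennreal (exp R)" by (rule V(2))
    finally show "(\<integral>\<^sup>+ \<omega>. ennreal (exp (\<alpha> * min (V m \<omega>) (real m))) \<partial>M) \<le> ennreal (exp R)" .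
  qed
  also have "\<dots> = ennreal (exp R)" by (simp add: Liminf_const)
  also have "\<dots> < \<infinity>" by simp
  finally show ?thesis .
qed

lemma levy_integrable_if_exp_TVc:
  assumes L: "levy_process M X A \<nu> \<gamma>" and S: "S > 0" and c: "c > 0" and \<alpha>: "\<alpha> > 0"
    and fin: "(\<integral>\<^sup>+ \<omega>. exp_ennreal \<alpha> (TVc c (\<lambda>t. X t \<omega>) S) \<partial>M) < \<infinity>"
  shows "(\<integral>\<^sup>+ x \<in> {x. \<bar>x\<bar> > 1}. ennreal (exp (\<alpha> * \<bar>x\<bar>)) \<partial>\<nu>) < \<infinity>"
proof -
  interpret prob_space M using L by (simp add: levy_process_def)
  have \<nu>: "levy_measure \<nu>" using L by (simp add: levy_process_def)
  have [measurable_cong]: "sets \<nu> = sets borel" using \<nu> by (simp add: levy_measure_def)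
  define \<mu> where "\<mu> n = distr M borel (X (S / Suc n))" for n
  have h: "S / Suc n \<ge> 0" for n using S by simp
  have \<mu>: "real_distribution (\<mu> n)" for n
    unfolding \<mu>_def by (rule levy_process_grid(4)[OF L h])
  have ch: "char (\<mu> n) u = exp (complex_of_real (S / Suc n) * levy_exponent A \<nu> \<gamma> u)" for n u
    unfolding \<mu>_def by (rule levy_process_char[OF L S])
  define K where "K = enn2real (\<integral>\<^sup>+ \<omega>. exp_ennreal \<alpha> (TVc c (\<lambda>t. X t \<omega>) S) \<partial>M)"
  define p :: "real \<Rightarrow> real" where "p x = max (\<bar>x\<bar> - c) 0" for x
  \<comment> \<open>Capping at m makes a bounded continuous function that vanishes for |x| < c, so
    \<open>levy_small_time_limit\<close> applies with \<delta> = c.\<close>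
  define g :: "real \<Rightarrow> real \<Rightarrow> real" where "g m x = min (exp (\<alpha> * p x) - 1) m" for m x
  have [measurable]: "p \<in> borel_measurable borel" "g m \<in> borel_measurable borel" for m
    unfolding p_def[abs_def] g_def[abs_def] by measurable
  have p0: "p x \<ge> 0" for x by (simp add: p_def)
  have ep: "exp (\<alpha> * p x) \<ge> 1" for x using \<alpha> p0 by simp
  have g_bounds: "0 \<le> g m x" "g m x \<le> m" if "m \<ge> 0" for m x using ep[of x] that by (auto simp: g_def)
  have g_zero: "g m x = 0" if "\<bar>x\<bar> < c" "m \<ge> 0" for m x using that by (simp add: g_def p_def)
  \<comment> \<open>The uniform grid is one admissible partition, and the exponential of its sum is
    a product of independent, identically distributed factors.\<close>
  have moment: "(\<integral>\<^sup>+ x. ennreal (exp (\<alpha> * p x)) \<partial>\<mu> n) ^ Suc n \<le> ennreal K" for n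
  proof -
    let ?D = "\<lambda>i \<omega>. X (real (Suc i) * (S / Suc n)) \<omega> - X (real i * (S / Suc n)) \<omega>"
    note G = levy_process_grid[OF L h[of n]]
    note G(1)[measurable]
    have "(\<integral>\<^sup>+ x. ennreal (exp (\<alpha> * p x)) \<partial>\<mu> n) = (\<integral>\<^sup>+ \<omega>. ennreal (exp (\<alpha> * p (?D i \<omega>))) \<partial>M)" for i
      unfolding \<mu>_def G(2)[of i, symmetric] by (rule nn_integral_distr[OF G(1)]) measurable
    then have "(\<integral>\<^sup>+ x. ennreal (exp (\<alpha> * p x)) \<partial>\<mu> n) ^ Suc n = (\<Prod>i<Suc n. \<integral>\<^sup>+ \<omega>. ennreal (exp (\<alpha> * p (?D i \<omega>))) \<partial>M)"
      by simp
    also have "\<dots> = (\<integral>\<^sup>+ \<omega>. (\<Prod>i<Suc n. ennreal (exp (\<alpha> * p (?D i \<omega>)))) \<partial>M)"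
    proof (rule indep_vars_nn_integral[symmetric])
      show "indep_vars (\<lambda>_. borel) (\<lambda>i \<omega>. ennreal (exp (\<alpha> * p (?D i \<omega>)))) {..<Suc n}"
        by (rule indep_vars_compose2[OF G(3)[of "Suc n"]]) measurable
    qed auto
    also have "\<dots> \<le> (\<integral>\<^sup>+ \<omega>. exp_ennreal \<alpha> (TVc c (\<lambda>t. X t \<omega>) S) \<partial>M)"
    proof (rule nn_integral_mono)
      fix \<omega>
      have "(\<Prod>i<Suc n. ennreal (exp (\<alpha> * p (?D i \<omega>)))) = ennreal (\<Prod>i<Suc n. exp (\<alpha> * p (?D i \<omega>)))"
        by (rule prod_ennreal) simp
      also have "(\<Prod>i<Suc n. exp (\<alpha> * p (?D i \<omega>))) = exp (\<alpha> * (\<Sum>i<Suc n. p (?D i \<omega>)))"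
        unfolding sum_distrib_left by (rule exp_sum[symmetric]) simp
      also have "ennreal \<dots> \<le> exp_ennreal \<alpha> (TVc c (\<lambda>t. X t \<omega>) S)"
        using TVc_ge_grid[OF S, where f="\<lambda>t. X t \<omega>"] \<alpha> p0 unfolding p_def
        by (intro exp_ennreal_ge) (auto intro!: sum_nonneg simp del: sum.lessThan_Suc of_nat_Suc)
      finally show "(\<Prod>i<Suc n. ennreal (exp (\<alpha> * p (?D i \<omega>)))) \<le> exp_ennreal \<alpha> (TVc c (\<lambda>t. X t \<omega>) S)" .
    qed
    also have "\<dots> = ennreal K" unfolding K_def using fin by (simp add: ennreal_enn2real)
    finally show ?thesis .
  qed
  have K: "K \<ge> 0" by (simp add: K_def)
  have small: "real (Suc n) * (LINT x|\<mu> n. g m x) \<le> K" if "m \<ge> 0" for n m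
  proof -
    interpret \<mu>: real_distribution "\<mu> n" by (rule \<mu>)
    have i: "integrable (\<mu> n) (g m)" by (rule \<mu>.integrable_const_bound[where B=m]) (use g_bounds[OF that] in auto)
    let ?G = "LINT x|\<mu> n. g m x"
    have G0: "?G \<ge> 0" using g_bounds[OF that] by (intro integral_nonneg_AE) auto
    have "ennreal (1 + ?G) = ennreal (LINT x|\<mu> n. 1 + g m x)" using i \<mu>.prob_space by simp
    also have "\<dots> = (\<integral>\<^sup>+ x. ennreal (1 + g m x) \<partial>\<mu> n)"
      using i g_bounds[OF that] by (intro nn_integral_eq_integral[symmetric]) auto
    also have "\<dots> \<le> (\<integral>\<^sup>+ x. ennreal (exp (\<alpha> * p x)) \<partial>\<mu> n)"
      by (intro nn_integral_mono ennreal_leI) (simp add: g_def)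
    finally have "ennreal (1 + ?G) ^ Suc n \<le> (\<integral>\<^sup>+ x. ennreal (exp (\<alpha> * p x)) \<partial>\<mu> n) ^ Suc n" by (intro power_mono) auto
    also note moment
    finally have "ennreal ((1 + ?G) ^ Suc n) \<le> ennreal K" using G0 by (simp only: ennreal_power add_nonneg_nonneg zero_le_one)
    then have "(1 + ?G) ^ Suc n \<le> K" using K by (simp only: ennreal_le_iff)
    moreover have "1 + real (Suc n) * ?G \<le> (1 + ?G) ^ Suc n" using G0 by (intro Bernoulli_inequality) simp
    ultimately show ?thesis by linarith
  qed
  have limit: "S * (LINT x|\<nu>. g m x) \<le> K" if "m \<ge> 0" for m
  proof (rule LIMSEQ_le_const2)
    show "(\<lambda>n. real (Suc n) * (LINT x|\<mu> n. g m x)) \<longlonglongrightarrow> S * (LINT x|\<nu>. g m x)"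
    proof (rule levy_small_time_limit[OF \<nu> \<mu> ch S])
      show "isCont (g m) x" for x unfolding g_def[abs_def] p_def by (intro continuous_intros)
      show "\<bar>g m x\<bar> \<le> m" for x using g_bounds[OF that, of x] by simp
      show "g m x = 0" if "\<bar>x\<bar> < c" for x using g_zero that \<open>m \<ge> 0\<close> by simp
    qed (rule c)
  qed (use small[OF that] in auto)
  \<comment> \<open>The Bochner integral of a nonintegrable function is 0, so without this the bound
    in \<open>limit\<close> would not carry over to the nonnegative integral.\<close>
  have gi: "integrable \<nu> (g m)" if "m \<ge> 0" for m
  proof (rule Bochner_Integration.integrable_bound)
    define k where "k = min 1 (c\<^sup>2)"
    have k: "k > 0" using c by (simp add: k_def)
    show "integrable \<nu> (\<lambda>x. m / k * min 1 (x\<^sup>2))"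
      by (intro integrable_mult_right levy_measure_integrable_min \<nu>)
    have "g m x \<le> m / k * min 1 (x\<^sup>2)" for x
    proof (cases "\<bar>x\<bar> < c")
      case True
      then show ?thesis using g_zero[OF True that] that k by (simp add: divide_nonneg_pos)
    next
      case False
      then have "c\<^sup>2 \<le> x\<^sup>2" using c by (simp add: abs_le_square_iff[symmetric])
      then have le: "k \<le> min 1 (x\<^sup>2)" unfolding k_def by linarith
      have "m = m / k * k" using k by simp
      also have "\<dots> \<le> m / k * min 1 (x\<^sup>2)"
        using le k that by (intro mult_left_mono divide_nonneg_pos)
      finally show ?thesis using g_bounds(2)[OF that, of x] by linarith
    qed
    then have "norm (g m x) \<le> norm (m / k * min 1 (x\<^sup>2))" for x
      unfolding real_norm_def using g_bounds(1)[OF that, of x] abs_ge_self[of "m / k * min 1 (x\<^sup>2)"]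
      by (metis abs_of_nonneg order_trans)
    then show "AE x in \<nu>. norm (g m x) \<le> norm (m / k * min 1 (x\<^sup>2))" by (intro AE_I2)
  qed simp
  have "(\<integral>\<^sup>+ x. ennreal (exp (\<alpha> * p x) - 1) \<partial>\<nu>) \<le> (\<integral>\<^sup>+ x. liminf (\<lambda>m. ennreal (g (real m) x)) \<partial>\<nu>)"
  proof (rule nn_integral_mono)
    fix x
    have "eventually (\<lambda>m. exp (\<alpha> * p x) - 1 \<le> real m) sequentially"
      using filterlim_real_sequentially by (simp add: filterlim_at_top)
    then have "eventually (\<lambda>m. ennreal (g (real m) x) = ennreal (exp (\<alpha> * p x) - 1)) sequentially"
      by eventually_elim (simp add: g_def)
    then have "(\<lambda>m. ennreal (g (real m) x)) \<longlonglongrightarrow> ennreal (exp (\<alpha> * p x) - 1)"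
      by (rule tendsto_eventually)
    then show "ennreal (exp (\<alpha> * p x) - 1) \<le> liminf (\<lambda>m. ennreal (g (real m) x))"
      by (simp add: lim_imp_Liminf)
  qed
  \<comment> \<open>Fatou's lemma removes the cap, as the capped integrals are all at most K /
    S.\<close>
  also have "\<dots> \<le> liminf (\<lambda>m. \<integral>\<^sup>+ x. ennreal (g (real m) x) \<partial>\<nu>)"
    by (rule nn_integral_liminf) measurable
  also have "\<dots> \<le> liminf (\<lambda>m. ennreal (K / S))"
  proof (intro Liminf_mono always_eventually allI)
    fix m :: nat
    have "(\<integral>\<^sup>+ x. ennreal (g (real m) x) \<partial>\<nu>) = ennreal (LINT x|\<nu>. g (real m) x)"
      using gi g_bounds by (intro nn_integral_eq_integral) auto
    also have "\<dots> \<le> ennreal (K / S)"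
      using limit[of "real m"] S by (intro ennreal_leI) (simp add: field_simps)
    finally show "(\<integral>\<^sup>+ x. ennreal (g (real m) x) \<partial>\<nu>) \<le> ennreal (K / S)" .
  qed
  also have "\<dots> = ennreal (K / S)" by (simp add: Liminf_const)
  finally have jumps: "(\<integral>\<^sup>+ x. ennreal (exp (\<alpha> * p x) - 1) \<partial>\<nu>) < \<infinity>"
    by (rule order_le_less_trans) simp
  have "(\<integral>\<^sup>+ x \<in> {x. \<bar>x\<bar> > 1}. ennreal (exp (\<alpha> * \<bar>x\<bar>)) \<partial>\<nu>)
      \<le> (\<integral>\<^sup>+ x. ennreal (exp (\<alpha> * c)) * (ennreal (exp (\<alpha> * p x) - 1) + ennreal (min 1 (x\<^sup>2))) \<partial>\<nu>)"
  \<comment> \<open>Passing from |x| to \<open>p x\<close> costs the factor exp (\<alpha> * c). The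
    1 subtracted from the exponential is restored by \<open>min 1 (x\<^sup>2)\<close>, which equals
    1 where |x| > 1 and is integrable.\<close>
  proof (rule nn_integral_mono)
    fix x
    show "ennreal (exp (\<alpha> * \<bar>x\<bar>)) * indicator {x. \<bar>x\<bar> > 1} x
        \<le> ennreal (exp (\<alpha> * c)) * (ennreal (exp (\<alpha> * p x) - 1) + ennreal (min 1 (x\<^sup>2)))"
    proof (cases "\<bar>x\<bar> > 1")
      case True
      then have 1: "min 1 (x\<^sup>2) = 1" using abs_square_le_1[of x] by simp
      have "\<alpha> * \<bar>x\<bar> \<le> \<alpha> * (c + p x)" using \<alpha> by (intro mult_left_mono) (auto simp: p_def)
      then have "exp (\<alpha> * \<bar>x\<bar>) \<le> exp (\<alpha> * c) * exp (\<alpha> * p x)" by (simp add: algebra_simps flip: exp_add)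
      then have "ennreal (exp (\<alpha> * \<bar>x\<bar>)) \<le> ennreal (exp (\<alpha> * c) * ((exp (\<alpha> * p x) - 1) + 1))" by (simp add: ennreal_leI)
      also have "\<dots> = ennreal (exp (\<alpha> * c)) * (ennreal (exp (\<alpha> * p x) - 1) + ennreal 1)"
        using ep[of x] by (subst ennreal_mult, simp, simp, subst ennreal_plus) auto
      finally show ?thesis using True 1 by simp
    qed simp
  qed
  also have "\<dots> = ennreal (exp (\<alpha> * c)) * ((\<integral>\<^sup>+ x. ennreal (exp (\<alpha> * p x) - 1) \<partial>\<nu>) + (\<integral>\<^sup>+ x. ennreal (min 1 (x\<^sup>2)) \<partial>\<nu>))"
    by (subst nn_integral_cmult, measurable, subst nn_integral_add) auto
  also have "\<dots> < \<infinity>"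
    using jumps \<nu> by (auto simp: levy_measure_def ennreal_mult_less_top)
  finally show ?thesis .
qed

theorem theorem3:
  fixes M :: "'a measure" and X :: "real \<Rightarrow> 'a \<Rightarrow> real"
    and A \<gamma> S c \<alpha> :: real and \<nu> :: "real measure"
  assumes "levy_process M X A \<nu> \<gamma>"
    and "S > 0" and "c > 0" and "\<alpha> > 0"
  shows "(\<integral>\<^sup>+ \<omega>. exp_ennreal \<alpha> (TVc c (\<lambda>t. X t \<omega>) S) \<partial>M) < \<infinity> \<longleftrightarrow>
         (\<integral>\<^sup>+ x \<in> {x. \<bar>x\<bar> > 1}. ennreal (exp (\<alpha> * \<bar>x\<bar>)) \<partial>\<nu>) < \<infinity>"
  using levy_integrable_if_exp_TVc[OF assms] exp_TVc_integrable_if[OF assms] by blast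

end
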